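(* Let $j,k$ be positive integers and let $H$ be a non-zero left-invariant closed 3-form on the Heisenberg group $H_3$, with induced forms on the nilmanifolds $E_k=\Lambda_k\backslash H_3$ and $E_j=\Lambda_j\backslash H_3$ again denoted $H$. Then the pair $(E_k,H)$ is invariantly $T$-dual to $(E_j,H)$. Moreover, $E_j$ is not diffeomorphic to $E_{j'}$ if $j\neq j'$.
   Context: $H_3$ is $\mathbb R^3$ with the multiplication $(x,y,z)\cdot(x',y',z')=\bigl(x+x',\,y+y',\,z+z'+\tfrac12(xy'-yx')\bigr)$. For each positive integer $k$, $\Lambda_k=\mathbb Z\times\mathbb Z\times\frac1{2k}\mathbb Z$, a discrete cocompact subgroup of $H_3$, and $E_k=\Lambda_k\backslash H_3$. With $A=\{(0,0,z)\}$ the center of $H_3$, $E_k$ is the total space of a principal circle bundle over $T^2=\mathbb Z^2\backslash\mathbb R^2$, with structure group $(\Lambda_k\cap A)\backslash A$ acting by right multiplication and projection $\Lambda_k(x,y,z)\mapsto\mathbb Z^2(x,y)$. A form on a nilmanifold $\Lambda\backslash G$ is invariant if its pullback to $G$ is left invariant. An invariant closed 3-form on $E_k$ is admissible for this bundle if it vanishes whenever two of its arguments are tangent to the fibers. Invariant $T$-duality: let $E,E^\vee$ be principal bundles over the same nilmanifold $M$ with fibers tori $T,T^\vee$ of the same dimension, with admissible closed invariant 3-forms $H,H^\vee$, and let $p,p^\vee$ be the projections of $E\times_ME^\vee$ (also a nilmanifold) to $E,E^\vee$. $(E,H)$ and $(E^\vee,H^\vee)$ are invariantly $T$-dual if there is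 an invariant 2-form $F$ on $E\times_ME^\vee$, non-degenerate on the fibers (as a pairing between the tangent spaces of $T$ and $T^\vee$), with $p^*H-p^{\vee*}H^\vee=dF$. *)

theory Defs
  imports
    "HOL-Analysis.Analysis"
    "HOL-Algebra.Generated_Groups"
    "HOL-Library.NList"
begin

section \<open>Smooth functions and differential forms on a linear space\<close>

text \<open>
  Everything is relative to a linear subspace \<open>V\<close> of a Euclidean space, because the group
  underlying a fibre product is a proper subspace of a product.  All derivatives are taken in
  directions of \<open>V\<close> only; \<open>W\<close> is meant to be relatively open in \<open>V\<close>.
\<close>

definition dirD :: "('a::real_normed_vector \<Rightarrow> 'b::real_normed_vector) \<Rightarrow> 'a \<Rightarrow> 'a \<Rightarrow> 'b" where
  "dirD f x v = vector_derivative (\<lambda>t. f (x + t *\<^sub>R v)) (at 0)"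

primrec Ck :: "nat \<Rightarrow> 'a::real_normed_vector set \<Rightarrow> 'a set \<Rightarrow> ('a \<Rightarrow> 'b::real_normed_vector) \<Rightarrow> bool" where
  "Ck 0 V W f \<longleftrightarrow> continuous_on W f"
| "Ck (Suc n) V W f \<longleftrightarrow> f differentiable_on W \<and> (\<forall>v\<in>V. Ck n V W (\<lambda>x. dirD f x v))"

definition smooth_in :: "'a::real_normed_vector set \<Rightarrow> 'a set \<Rightarrow> ('a \<Rightarrow> 'b::real_normed_vector) \<Rightarrow> bool" where
  "smooth_in V W f \<longleftrightarrow> (\<forall>n. Ck n V W f)"

text \<open>
  A \<open>k\<close>-form assigns a number to a point \<open>x\<close> and a list of \<open>k\<close> tangent vectors at \<open>x\<close>; its values
  on other arguments are irrelevant.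
\<close>

type_synonym 'a form = "'a \<Rightarrow> 'a list \<Rightarrow> real"

definition diff_form :: "nat \<Rightarrow> 'a::real_normed_vector set \<Rightarrow> 'a form \<Rightarrow> bool" where
  "diff_form k V \<omega> \<longleftrightarrow>
     (\<forall>x\<in>V. \<forall>vs\<in>nlists k V. \<forall>i<k. \<forall>u\<in>V. \<forall>w\<in>V. \<forall>a b.
        \<omega> x (vs[i := a *\<^sub>R u + b *\<^sub>R w]) = a * \<omega> x (vs[i := u]) + b * \<omega> x (vs[i := w])) \<and>
     (\<forall>x\<in>V. \<forall>vs\<in>nlists k V. \<not> distinct vs \<longrightarrow> \<omega> x vs = 0) \<and>
     (\<forall>vs\<in>nlists k V. smooth_in V V (\<lambda>x. \<omega> x vs))"

text \<open>
  Exterior derivative by the invariant formula on constant vector fields, whose brackets vanish;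
  normalised without a factor \<open>1/(k+1)\<close>.
\<close>

definition extd :: "'a::real_normed_vector form \<Rightarrow> 'a form" where
  "extd \<omega> x vs =
     (\<Sum>i<length vs. (-1) ^ i * dirD (\<lambda>y. \<omega> y (take i vs @ drop (Suc i) vs)) x (vs ! i))"

definition closed_form :: "nat \<Rightarrow> 'a::real_normed_vector set \<Rightarrow> 'a form \<Rightarrow> bool" where
  "closed_form k V \<omega> \<longleftrightarrow> (\<forall>x\<in>V. \<forall>vs\<in>nlists (Suc k) V. extd \<omega> x vs = 0)"

definition nonzero_form :: "nat \<Rightarrow> 'a set \<Rightarrow> 'a form \<Rightarrow> bool" where
  "nonzero_form k V \<omega> \<longleftrightarrow> (\<exists>x\<in>V. \<exists>vs\<in>nlists k V. \<omega> x vs \<noteq> 0)"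

definition left_invariant :: "nat \<Rightarrow> ('a::real_normed_vector) monoid \<Rightarrow> 'a form \<Rightarrow> bool" where
  "left_invariant k G \<omega> \<longleftrightarrow>
     (\<forall>g\<in>carrier G. \<forall>x\<in>carrier G. \<forall>vs\<in>nlists k (carrier G).
        \<omega> (g \<otimes>\<^bsub>G\<^esub> x) (map (dirD (\<lambda>y. g \<otimes>\<^bsub>G\<^esub> y) x) vs) = \<omega> x vs)"


section \<open>Nilmanifolds\<close>

text \<open>A pair \<open>(G, \<Lambda>)\<close>, standing for the space \<open>\<Lambda>\G\<close> of cosets \<open>\<Lambda>x\<close>.\<close>

record 'a nilspace =
  grp :: "'a monoid"
  lat :: "'a set"

abbreviation space_of :: "'a nilspace \<Rightarrow> 'a set" where
  "space_of X \<equiv> carrier (grp X)"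

definition points :: "'a nilspace \<Rightarrow> 'a set set" where
  "points X = rcosets\<^bsub>grp X\<^esub> (lat X)"

definition proj :: "'a nilspace \<Rightarrow> 'a \<Rightarrow> 'a set" where
  "proj X x = lat X #>\<^bsub>grp X\<^esub> x"

definition quot_top :: "('a::topological_space) nilspace \<Rightarrow> 'a set topology" where
  "quot_top X = topology (\<lambda>U. U \<subseteq> points X \<and>
     openin (top_of_set (space_of X)) {x \<in> space_of X. proj X x \<in> U})"

primrec lower_central :: "('a, 'b) monoid_scheme \<Rightarrow> nat \<Rightarrow> 'a set" where
  "lower_central G 0 = carrier G"
| "lower_central G (Suc n) =
     generate G {g \<otimes>\<^bsub>G\<^esub> h \<otimes>\<^bsub>G\<^esub> inv\<^bsub>G\<^esub> g \<otimes>\<^bsub>G\<^esub> inv\<^bsub>G\<^esub> h | g h. g \<in> carrier G \<and> h \<in> lower_central G n}"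

text \<open>
  Simply connected nilpotent Lie groups in exponential coordinates: the group is its Lie algebra,
  a linear space in which the lines through \<open>0\<close> are the one-parameter subgroups.  In these
  coordinates every smooth homomorphism is linear.
\<close>

definition nilpotent_lie_group :: "('a::euclidean_space) monoid \<Rightarrow> bool" where
  "nilpotent_lie_group G \<longleftrightarrow>
     group G \<and> subspace (carrier G) \<and>
     smooth_in (carrier G \<times> carrier G) (carrier G \<times> carrier G) (\<lambda>(x, y). x \<otimes>\<^bsub>G\<^esub> y) \<and>
     smooth_in (carrier G) (carrier G) (\<lambda>x. inv\<^bsub>G\<^esub> x) \<and>
     (\<forall>v\<in>carrier G. \<forall>s t. (s *\<^sub>R v) \<otimes>\<^bsub>G\<^esub> (t *\<^sub>R v) = (s + t) *\<^sub>R v) \<and>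
     (\<exists>n. lower_central G n = {\<one>\<^bsub>G\<^esub>})"

definition nilmanifold :: "('a::euclidean_space) nilspace \<Rightarrow> bool" where
  "nilmanifold X \<longleftrightarrow> nilpotent_lie_group (grp X) \<and> subgroup (lat X) (grp X) \<and>
     discrete (lat X) \<and> compact_space (quot_top X)"


subsection \<open>Smooth maps\<close>

text \<open>
  The charts of \<open>\<Lambda>\G\<close> are the inverses of the quotient map on open sets on which it is injective.
\<close>

definition chart_dom :: "('a::euclidean_space) nilspace \<Rightarrow> 'a set \<Rightarrow> bool" where
  "chart_dom X U \<longleftrightarrow> openin (top_of_set (space_of X)) U \<and> inj_on (proj X) U"

definition smooth_map ::
  "('a::euclidean_space) nilspace \<Rightarrow> ('b::euclidean_space) nilspace \<Rightarrow> ('a set \<Rightarrow> 'b set) \<Rightarrow> bool" where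
  "smooth_map X Y f \<longleftrightarrow> f \<in> points X \<rightarrow> points Y \<and>
     (\<forall>p\<in>points X. \<exists>U W. chart_dom X U \<and> chart_dom Y W \<and> p \<in> proj X ` U \<and>
        f ` proj X ` U \<subseteq> proj Y ` W \<and>
        smooth_in (space_of X) U (the_inv_into W (proj Y) \<circ> f \<circ> proj X))"

definition diffeomorphic :: "('a::euclidean_space) nilspace \<Rightarrow> ('b::euclidean_space) nilspace \<Rightarrow> bool" where
  "diffeomorphic X Y \<longleftrightarrow> (\<exists>f. bij_betw f (points X) (points Y) \<and>
     smooth_map X Y f \<and> smooth_map Y X (the_inv_into (points X) f))"


subsection \<open>Tangent vectors and forms\<close>

text \<open>
  The tangent bundle of \<open>\<Lambda>\G\<close> is \<open>\<Lambda>\TG\<close>: a tangent vector is a \<open>\<Lambda>\<close>-orbit of pairs \<open>(x, v)\<close> with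
  \<open>v\<close> tangent to \<open>G\<close> at \<open>x\<close>, and \<open>dproj X x\<close> is the differential of the quotient map at \<open>x\<close>.
\<close>

type_synonym 'a tvec = "('a \<times> 'a) set"
type_synonym 'a nform = "'a set \<Rightarrow> 'a tvec list \<Rightarrow> real"

definition dproj :: "('a::real_normed_vector) nilspace \<Rightarrow> 'a \<Rightarrow> 'a \<Rightarrow> 'a tvec" where
  "dproj X x v = (\<lambda>l. (l \<otimes>\<^bsub>grp X\<^esub> x, dirD (\<lambda>y. l \<otimes>\<^bsub>grp X\<^esub> y) x v)) ` lat X"

definition tangent :: "('a::real_normed_vector) nilspace \<Rightarrow> 'a set \<Rightarrow> 'a tvec set" where
  "tangent X p = {dproj X x v | x v. x \<in> p \<and> v \<in> space_of X}"

definition pull :: "('a::real_normed_vector) nilspace \<Rightarrow> 'a nform \<Rightarrow> 'a form" where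
  "pull X \<omega> x vs = \<omega> (proj X x) (map (dproj X x) vs)"

definition nil_form :: "nat \<Rightarrow> ('a::real_normed_vector) nilspace \<Rightarrow> 'a nform \<Rightarrow> bool" where
  "nil_form k X \<omega> \<longleftrightarrow> diff_form k (space_of X) (pull X \<omega>)"

definition invariant_form :: "nat \<Rightarrow> ('a::real_normed_vector) nilspace \<Rightarrow> 'a nform \<Rightarrow> bool" where
  "invariant_form k X \<omega> \<longleftrightarrow> nil_form k X \<omega> \<and> left_invariant k (grp X) (pull X \<omega>)"

text \<open>
  The form induced on \<open>\<Lambda>\G\<close> by a \<open>\<Lambda>\<close>-invariant form on \<open>G\<close>: lift the point to any \<open>x \<in> p\<close>, and
  each tangent vector \<open>t\<close> to the unique \<open>v\<close> with \<open>(x, v) \<in> t\<close>.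
\<close>

definition induced :: "'a form \<Rightarrow> 'a nform" where
  "induced \<omega> p ts = (let x = SOME x. x \<in> p in \<omega> x (map (\<lambda>t. THE v. (x, v) \<in> t) ts))"

definition nil_extd :: "('a::real_normed_vector) nilspace \<Rightarrow> 'a nform \<Rightarrow> 'a nform" where
  "nil_extd X \<omega> = induced (extd (pull X \<omega>))"

definition nil_closed :: "nat \<Rightarrow> ('a::real_normed_vector) nilspace \<Rightarrow> 'a nform \<Rightarrow> bool" where
  "nil_closed k X \<omega> \<longleftrightarrow> (\<forall>p\<in>points X. \<forall>ts\<in>nlists (Suc k) (tangent X p). nil_extd X \<omega> p ts = 0)"

text \<open>
  A homomorphism \<open>\<phi>\<close> mapping the lattice \<open>\<Lambda>\<close> onto the lattice \<open>\<Lambda>'\<close> induces a map of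
  nilmanifolds; on cosets it is the image under \<open>\<phi>\<close>, on tangent vectors the image under \<open>d\<phi>\<close>.
\<close>

definition tmap :: "('a::real_normed_vector \<Rightarrow> 'b::real_normed_vector) \<Rightarrow> 'a tvec \<Rightarrow> 'b tvec" where
  "tmap \<phi> t = (\<lambda>(x, v). (\<phi> x, dirD \<phi> x v)) ` t"

definition pullback :: "('a::real_normed_vector \<Rightarrow> 'b::real_normed_vector) \<Rightarrow> 'b nform \<Rightarrow> 'a nform" where
  "pullback \<phi> \<omega> p ts = \<omega> (\<phi> ` p) (map (tmap \<phi>) ts)"

text \<open>Tangent to the fibres of the map induced by \<open>\<phi>\<close>, respectively zero.\<close>

definition vertical :: "('a::real_normed_vector \<Rightarrow> 'b::real_normed_vector) \<Rightarrow> 'a tvec \<Rightarrow> bool" where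
  "vertical \<phi> t \<longleftrightarrow> (\<forall>(x, v)\<in>t. dirD \<phi> x v = 0)"

definition zero_tvec :: "('a::real_normed_vector) tvec \<Rightarrow> bool" where
  "zero_tvec t \<longleftrightarrow> (\<forall>(x, v)\<in>t. v = 0)"


section \<open>Principal torus bundles and invariant T-duality\<close>

text \<open>
  The projection \<open>\<Lambda>\G \<rightarrow> \<Gamma>\N\<close> is induced by a surjective homomorphism \<open>q : G \<rightarrow> N\<close> with connected
  central kernel \<open>A\<close> and \<open>q(\<Lambda>) = \<Gamma>\<close>; the structure group is the torus \<open>(\<Lambda> \<inter> A)\A\<close>, acting by right
  multiplication.
\<close>

record ('a, 'b) nilbundle =
  total_space :: "'a nilspace"
  base_space :: "'b nilspace"
  hmap :: "'a \<Rightarrow> 'b"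

definition fibre :: "('a, 'b) nilbundle \<Rightarrow> 'a nilspace" where
  "fibre B = (let A = kernel (grp (total_space B)) (grp (base_space B)) (hmap B) in
     \<lparr>grp = (grp (total_space B))\<lparr>carrier := A\<rparr>, lat = lat (total_space B) \<inter> A\<rparr>)"

definition principal_torus_bundle :: "('a::euclidean_space, 'b::euclidean_space) nilbundle \<Rightarrow> bool" where
  "principal_torus_bundle B \<longleftrightarrow>
     nilmanifold (total_space B) \<and> nilmanifold (base_space B) \<and>
     hmap B \<in> hom (grp (total_space B)) (grp (base_space B)) \<and>
     smooth_in (space_of (total_space B)) (space_of (total_space B)) (hmap B) \<and>
     hmap B ` space_of (total_space B) = space_of (base_space B) \<and>
     hmap B ` lat (total_space B) = lat (base_space B) \<and>
     connected (space_of (fibre B)) \<and>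
     (\<forall>a\<in>space_of (fibre B). \<forall>g\<in>space_of (total_space B).
        a \<otimes>\<^bsub>grp (total_space B)\<^esub> g = g \<otimes>\<^bsub>grp (total_space B)\<^esub> a) \<and>
     compact_space (quot_top (fibre B))"

definition admissible :: "('a::euclidean_space, 'b::euclidean_space) nilbundle \<Rightarrow> 'a nform \<Rightarrow> bool" where
  "admissible B H \<longleftrightarrow>
     (\<forall>p\<in>points (total_space B). \<forall>ts\<in>nlists 3 (tangent (total_space B) p).
        (\<exists>i<3. \<exists>j<3. i \<noteq> j \<and> vertical (hmap B) (ts ! i) \<and> vertical (hmap B) (ts ! j)) \<longrightarrow> H p ts = 0)"

text \<open>
  \<open>E \<times>\<^sub>M E'\<close> as the nilmanifold of \<open>G \<times>\<^sub>N G'\<close> modulo \<open>\<Lambda> \<times>\<^sub>\<Gamma> \<Lambda>'\<close>; see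
  \<open>bij_betw_fibre_product\<close> below for the identification with pairs of points.
\<close>

definition fibre_product :: "('a, 'm) nilbundle \<Rightarrow> ('b, 'm) nilbundle \<Rightarrow> ('a \<times> 'b) nilspace" where
  "fibre_product B B' =
     \<lparr>grp = (grp (total_space B) \<times>\<times> grp (total_space B'))
        \<lparr>carrier := {(g, h). g \<in> space_of (total_space B) \<and> h \<in> space_of (total_space B') \<and> hmap B g = hmap B' h}\<rparr>,
      lat = {(g, h). g \<in> lat (total_space B) \<and> h \<in> lat (total_space B') \<and> hmap B g = hmap B' h}\<rparr>"

text \<open>
  In \<open>E \<times>\<^sub>M E'\<close> the tangent spaces of the fibres \<open>T\<close> of \<open>E\<close> are the vectors vertical for the
  projection to \<open>E'\<close>, and those of \<open>T'\<close> the vectors vertical for the projection to \<open>E\<close>.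
\<close>

definition nondegenerate_on_fibres ::
  "('a::euclidean_space, 'm) nilbundle \<Rightarrow> ('b::euclidean_space, 'm) nilbundle \<Rightarrow> ('a \<times> 'b) nform \<Rightarrow> bool" where
  "nondegenerate_on_fibres B B' F \<longleftrightarrow>
     (\<forall>p\<in>points (fibre_product B B').
        let T = {t \<in> tangent (fibre_product B B') p. vertical snd t};
            T' = {t \<in> tangent (fibre_product B B') p. vertical fst t}
        in (\<forall>t\<in>T. \<not> zero_tvec t \<longrightarrow> (\<exists>t'\<in>T'. F p [t, t'] \<noteq> 0)) \<and>
           (\<forall>t'\<in>T'. \<not> zero_tvec t' \<longrightarrow> (\<exists>t\<in>T. F p [t, t'] \<noteq> 0)))"

text \<open>The fibres have the same dimension iff the total spaces do, the base being the same.\<close>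

definition invariantly_T_dual ::
  "('a::euclidean_space, 'm::euclidean_space) nilbundle \<Rightarrow> 'a nform \<Rightarrow>
   ('b::euclidean_space, 'm) nilbundle \<Rightarrow> 'b nform \<Rightarrow> bool" where
  "invariantly_T_dual B H B' H' \<longleftrightarrow>
     principal_torus_bundle B \<and> principal_torus_bundle B' \<and> base_space B = base_space B' \<and>
     dim (space_of (total_space B)) = dim (space_of (total_space B')) \<and>
     invariant_form 3 (total_space B) H \<and> nil_closed 3 (total_space B) H \<and> admissible B H \<and>
     invariant_form 3 (total_space B') H' \<and> nil_closed 3 (total_space B') H' \<and> admissible B' H' \<and>
     (\<exists>F. invariant_form 2 (fibre_product B B') F \<and> nondegenerate_on_fibres B B' F \<and>
        (\<forall>p\<in>points (fibre_product B B'). \<forall>ts\<in>nlists 3 (tangent (fibre_product B B') p).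
           pullback fst H p ts - pullback snd H' p ts = nil_extd (fibre_product B B') F p ts))"


lemma bij_betw_fibre_product:
  assumes B: "principal_torus_bundle B" and B': "principal_torus_bundle B'" and eq: "base_space B = base_space B'"
  shows "bij_betw (\<lambda>C. (fst ` C, snd ` C)) (points (fibre_product B B'))
    {(p, p'). p \<in> points (total_space B) \<and> p' \<in> points (total_space B') \<and> hmap B ` p = hmap B' ` p'}"
proof -
  define G where "G = grp (total_space B)"
  define G' where "G' = grp (total_space B')"
  define N where "N = grp (base_space B)"
  define L where "L = lat (total_space B)"
  define L' where "L' = lat (total_space B')"
  define q where "q = hmap B"
  define q' where "q' = hmap B'"
  have G: "group G" "group G'" "group N" "subgroup L G" "subgroup L' G'"
    "q \<in> hom G N" "q' \<in> hom G' N" "q ` L = q' ` L'"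
    using B B' eq
    by (simp_all add: principal_torus_bundle_def nilmanifold_def nilpotent_lie_group_def
        G_def G'_def N_def L_def L'_def q_def q'_def)
  interpret G: group G by (rule G)
  interpret G': group G' by (rule G)
  interpret N: group N by (rule G)
  have LG: "\<And>l. l \<in> L \<Longrightarrow> l \<in> carrier G" "\<And>l. l \<in> L' \<Longrightarrow> l \<in> carrier G'"
    using G(4,5) by (auto dest: subgroup.mem_carrier)
  have qc: "\<And>x. x \<in> carrier G \<Longrightarrow> q x \<in> carrier N" "\<And>x. x \<in> carrier G' \<Longrightarrow> q' x \<in> carrier N"
    using G(6,7) by (auto simp: hom_def)
  have qm: "\<And>x y. x \<in> carrier G \<Longrightarrow> y \<in> carrier G \<Longrightarrow> q (x \<otimes>\<^bsub>G\<^esub> y) = q x \<otimes>\<^bsub>N\<^esub> q y"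
    "\<And>x y. x \<in> carrier G' \<Longrightarrow> y \<in> carrier G' \<Longrightarrow> q' (x \<otimes>\<^bsub>G'\<^esub> y) = q' x \<otimes>\<^bsub>N\<^esub> q' y"
    using G(6,7) by (auto simp: hom_mult)
  let ?f = "\<lambda>C. (fst ` C, snd ` C)"
  define c where "c x y = {(l \<otimes>\<^bsub>G\<^esub> x, l' \<otimes>\<^bsub>G'\<^esub> y) | l l'. l \<in> L \<and> l' \<in> L' \<and> q l = q' l'}" for x y
  have pts: "points (fibre_product B B') =
      {c x y | x y. x \<in> carrier G \<and> y \<in> carrier G' \<and> q x = q' y}"
    unfolding points_def fibre_product_def RCOSETS_def r_coset_def c_def
    by (fastforce simp: G_def G'_def L_def L'_def q_def q'_def DirProd_def)
  have pE: "points (total_space B) = {L #>\<^bsub>G\<^esub> x | x. x \<in> carrier G}"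
    "points (total_space B') = {L' #>\<^bsub>G'\<^esub> x | x. x \<in> carrier G'}"
    by (auto simp: points_def RCOSETS_def G_def L_def G'_def L'_def)
  have fc: "fst ` c x y = L #>\<^bsub>G\<^esub> x" for x y
  proof -
    have "\<exists>l'\<in>L'. q l = q' l'" if "l \<in> L" for l using G(8) that by (metis imageE imageI)
    then show ?thesis by (force simp: c_def r_coset_def image_iff)
  qed
  have sc: "snd ` c x y = L' #>\<^bsub>G'\<^esub> y" for x y
  proof -
    have "\<exists>l\<in>L. q l = q' l'" if "l' \<in> L'" for l' using G(8) that by (metis imageE imageI)
    then show ?thesis by (force simp: c_def r_coset_def image_iff)
  qed
  have qi: "q ` (L #>\<^bsub>G\<^esub> x) = (q ` L) #>\<^bsub>N\<^esub> q x" if "x \<in> carrier G" for x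
    using that LG qm by (force simp: r_coset_def image_iff)
  have qi': "q' ` (L' #>\<^bsub>G'\<^esub> x) = (q' ` L') #>\<^bsub>N\<^esub> q' x" if "x \<in> carrier G'" for x
    using that LG qm by (force simp: r_coset_def image_iff)
  have cL: "c (m \<otimes>\<^bsub>G\<^esub> x) (m' \<otimes>\<^bsub>G'\<^esub> y) \<subseteq> c x y"
    if "m \<in> L" "m' \<in> L'" "q m = q' m'" "x \<in> carrier G" "y \<in> carrier G'" for m m' x y
  proof
    fix z assume "z \<in> c (m \<otimes>\<^bsub>G\<^esub> x) (m' \<otimes>\<^bsub>G'\<^esub> y)"
    then obtain l l' where l: "z = (l \<otimes>\<^bsub>G\<^esub> (m \<otimes>\<^bsub>G\<^esub> x), l' \<otimes>\<^bsub>G'\<^esub> (m' \<otimes>\<^bsub>G'\<^esub> y))" "l \<in> L" "l' \<in> L'" "q l = q' l'"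
      by (auto simp: c_def)
    then have "z = ((l \<otimes>\<^bsub>G\<^esub> m) \<otimes>\<^bsub>G\<^esub> x, (l' \<otimes>\<^bsub>G'\<^esub> m') \<otimes>\<^bsub>G'\<^esub> y)"
      using that LG by (simp add: G.m_assoc G'.m_assoc)
    moreover have "l \<otimes>\<^bsub>G\<^esub> m \<in> L" "l' \<otimes>\<^bsub>G'\<^esub> m' \<in> L'"
      using l that G(4,5) by (auto simp: subgroup.m_closed)
    moreover have "q (l \<otimes>\<^bsub>G\<^esub> m) = q' (l' \<otimes>\<^bsub>G'\<^esub> m')" using l that LG qm by simp
    ultimately show "z \<in> c x y" by (auto simp: c_def)
  qed
  have sub: "c x y \<subseteq> c u v"
    if "x \<in> carrier G" "y \<in> carrier G'" "q x = q' y" "u \<in> carrier G" "v \<in> carrier G'" "q u = q' v"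
      "L #>\<^bsub>G\<^esub> x = L #>\<^bsub>G\<^esub> u" "L' #>\<^bsub>G'\<^esub> y = L' #>\<^bsub>G'\<^esub> v" for x y u v
  proof -
    have "x \<in> L #>\<^bsub>G\<^esub> u" "y \<in> L' #>\<^bsub>G'\<^esub> v"
      using G.rcos_self[OF that(1) G(4)] G'.rcos_self[OF that(2) G(5)] that by auto
    then obtain m m' where m: "m \<in> L" "m' \<in> L'" "x = m \<otimes>\<^bsub>G\<^esub> u" "y = m' \<otimes>\<^bsub>G'\<^esub> v"
      by (auto simp: r_coset_def)
    then have "q m \<otimes>\<^bsub>N\<^esub> q u = q' m' \<otimes>\<^bsub>N\<^esub> q u" using that LG qm by metis
    then have "q m = q' m'" using m LG qc that by (metis N.right_cancel)
    with cL m that show ?thesis by metis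
  qed
  have "inj_on ?f (points (fibre_product B B'))"
  proof (rule inj_onI)
    fix C D assume CD: "C \<in> points (fibre_product B B')" "D \<in> points (fibre_product B B')"
      and e: "?f C = ?f D"
    from CD(1) obtain x y where C: "C = c x y" "x \<in> carrier G" "y \<in> carrier G'" "q x = q' y"
      unfolding pts by blast
    from CD(2) obtain u v where D: "D = c u v" "u \<in> carrier G" "v \<in> carrier G'" "q u = q' v"
      unfolding pts by blast
    have "L #>\<^bsub>G\<^esub> x = L #>\<^bsub>G\<^esub> u" "L' #>\<^bsub>G'\<^esub> y = L' #>\<^bsub>G'\<^esub> v" using e by (auto simp: C D fc sc)
    then show "C = D" using sub[of x y u v] sub[of u v x y] C D by (metis subset_antisym)
  qed
  moreover have "?f ` points (fibre_product B B') =
    {(p, p'). p \<in> points (total_space B) \<and> p' \<in> points (total_space B') \<and> q ` p = q' ` p'}" (is "_ = ?R")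
  proof (rule subset_antisym; rule subsetI)
    fix z assume "z \<in> ?f ` points (fibre_product B B')"
    then obtain x y where z: "z = ?f (c x y)" "x \<in> carrier G" "y \<in> carrier G'" "q x = q' y"
      unfolding pts by blast
    then have "q ` (L #>\<^bsub>G\<^esub> x) = q' ` (L' #>\<^bsub>G'\<^esub> y)" using qi qi' G(8) by metis
    then show "z \<in> ?R" unfolding pE z(1) fc sc using z by blast
  next
    fix z assume "z \<in> ?R"
    then obtain x y where z: "z = (L #>\<^bsub>G\<^esub> x, L' #>\<^bsub>G'\<^esub> y)" "x \<in> carrier G" "y \<in> carrier G'"
      "q ` (L #>\<^bsub>G\<^esub> x) = q' ` (L' #>\<^bsub>G'\<^esub> y)" unfolding pE by blast
    have "q x \<in> q ` (L #>\<^bsub>G\<^esub> x)" using G.rcos_self[OF z(2) G(4)] by blast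
    then obtain y' where y': "y' \<in> L' #>\<^bsub>G'\<^esub> y" "q x = q' y'" using z(4) by auto
    then have "y' \<in> carrier G'" using z LG by (auto simp: r_coset_def)
    moreover have "L' #>\<^bsub>G'\<^esub> y' = L' #>\<^bsub>G'\<^esub> y" using G'.repr_independence[OF y'(1) z(3) G(5)] by simp
    ultimately have "z = ?f (c x y')" "c x y' \<in> points (fibre_product B B')"
      unfolding pts using z y' by (auto simp: fc sc)
    then show "z \<in> ?f ` points (fibre_product B B')" by blast
  qed
  ultimately show ?thesis unfolding bij_betw_def q_def q'_def by blast
qed


section \<open>The Heisenberg nilmanifolds\<close>

definition H3 :: "(real \<times> real \<times> real) monoid" where
  "H3 = \<lparr>carrier = UNIV,
     mult = (\<lambda>(x, y, z) (x', y', z'). (x + x', y + y', z + z' + (x * y' - y * x') / 2)),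
     one = (0, 0, 0)\<rparr>"

definition Lambda :: "nat \<Rightarrow> (real \<times> real \<times> real) set" where
  "Lambda k = \<int> \<times> \<int> \<times> (\<lambda>n. n / (2 * real k)) ` \<int>"

definition E :: "nat \<Rightarrow> (real \<times> real \<times> real) nilspace" where
  "E k = \<lparr>grp = H3, lat = Lambda k\<rparr>"

definition T2 :: "(real \<times> real) nilspace" where
  "T2 = \<lparr>grp = \<lparr>carrier = UNIV, mult = (+), one = 0\<rparr>, lat = \<int> \<times> \<int>\<rparr>"

definition E_bundle :: "nat \<Rightarrow> (real \<times> real \<times> real, real \<times> real) nilbundle" where
  "E_bundle k = \<lparr>total_space = E k, base_space = T2, hmap = (\<lambda>(x, y, z). (x, y))\<rparr>"

end

theory Submission
  imports Defs
begin

text \<open>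
  A left-invariant 3-form on \<open>H3\<close> is \<open>c dx \<and> dy \<and> dz\<close>.  On the fibre product, with
  \<open>\<theta> = dz - (x dy - y dx) / 2\<close> on the first factor and \<open>\<theta>'\<close> its analogue on the second, one has
  \<open>d\<theta> = d\<theta>' = - dx \<and> dy\<close>, so \<open>F = c \<theta> \<and> \<theta>'\<close> satisfies
  \<open>dF = c dx \<and> dy \<and> (\<theta> - \<theta>') = c dx \<and> dy \<and> dz - c dx \<and> dy \<and> dz'\<close>, and it pairs the two fibres by
  \<open>c dz \<and> dz'\<close>.

  A diffeomorphism \<open>E j \<rightarrow> E i\<close> lifts to \<open>H3\<close> and hence induces an isomorphism
  \<open>Lambda j \<rightarrow> Lambda i\<close>.  It maps the generator \<open>(0, 0, 1 / (2 j))\<close> of the centre to a generator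
  of the centre, and the commutator of \<open>(1, 0, 0)\<close> and \<open>(0, 1, 0)\<close>, which is the \<open>2 j\<close>-th power of
  that generator, to a commutator of \<open>Lambda i\<close>; as these are \<open>2 i\<close>-th powers of central elements,
  \<open>i\<close> divides \<open>j\<close>.
\<close>

section \<open>Smoothness and compactness\<close>

text \<open>The coefficient \<open>c\<close> is constant because left translations of
  \<open>H3\<close> have unipotent differentials and so preserve the determinant. The forms \<theta>
  and \<theta>' and their derivative - dx \<and> dy are those of \<open>H3\<close> itself, whatever
  the lattice; hence one formula for F serves every pair \<open>j\<close>, \<open>k\<close>. For
  T-duality the obstacle is that a form on the quotient acts on orbits of tangent vectors, and
  \<open>induced\<close> evaluates it at a representative picked by \<open>SOME\<close>. Every
  identity is therefore moved to the group, either by left invariance or by lifting all vectors to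
  exactly the representative that was picked. For the diffeomorphism part the obstacle is that base
  points are not controlled: lifts of a map and of its inverse compose to left multiplication by
  some lattice element, so the two lattice homomorphisms are mutually inverse only up to
  conjugation. That is enough: both are still surjective, which makes them send centre to centre,
  and conjugation is trivial on the centre, so the two integers by which they act there have product
  1.\<close>

lemma dirD_eq:
  assumes "(f has_derivative f') (at x)"
  shows "dirD f x v = f' v"
proof -
  have "((\<lambda>t. x + t *\<^sub>R v) has_derivative (\<lambda>t. t *\<^sub>R v)) (at 0)"
    by (auto intro!: derivative_eq_intros)
  moreover have "(f has_derivative f') (at (x + 0 *\<^sub>R v))"
    using assms by simp
  ultimately have "((\<lambda>t. f (x + t *\<^sub>R v)) has_derivative (\<lambda>t. f' (t *\<^sub>R v))) (at 0)"
    by (rule has_derivative_compose)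
  moreover have "f' (t *\<^sub>R v) = t *\<^sub>R f' v" for t
    using assms has_derivative_linear linear_cmul by blast
  ultimately show ?thesis
    unfolding dirD_def by (intro vector_derivative_at) (simp add: has_vector_derivative_def)
qed

lemma dirD_cong:
  assumes V: "subspace V" "x \<in> V" "v \<in> V" and eq: "\<And>y. y \<in> V \<Longrightarrow> f y = g y"
  shows "dirD f x v = dirD g x v"
proof -
  have "x + t *\<^sub>R v \<in> V" for t
    using V by (intro subspace_add subspace_scale)
  then show ?thesis by (simp add: dirD_def eq)
qed

text \<open>All derivatives are taken along lines that stay in \<open>V\<close>, so values off
  \<open>V\<close> never enter. This matters for the fibre product, whose group is a proper
  subspace.\<close>

lemma Ck_cong:
  assumes V: "subspace V" and eq: "\<And>x. x \<in> V \<Longrightarrow> f x = g x" and f: "Ck n V V f"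
  shows "Ck n V V g"
  using eq f
proof (induction n arbitrary: f g)
  case 0
  then show ?case by (simp cong: continuous_on_cong)
next
  case (Suc n)
  have "g differentiable_on V"
    using Suc.prems unfolding differentiable_on_def
    by (metis Ck.simps(2) differentiable_on_def differentiable_transform_within zero_less_one)
  moreover have "Ck n V V (\<lambda>x. dirD g x v)" if "v \<in> V" for v
    using Suc.IH[of "\<lambda>x. dirD f x v"] Suc.prems that dirD_cong[OF V] by (metis Ck.simps(2))
  ultimately show ?case by simp
qed

lemma smooth_in_cong:
  assumes "subspace V" and "\<And>x. x \<in> V \<Longrightarrow> f x = g x" and "smooth_in V V f"
  shows "smooth_in V V g"
  using assms Ck_cong unfolding smooth_in_def by blast

text \<open>The directional derivatives are again polynomial, which is what lets smoothness of every
  order follow by iteration.\<close>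

lemma real_polynomial_function_has_derivative:
  fixes f :: "'a::real_normed_vector \<Rightarrow> real"
  assumes "real_polynomial_function f"
  shows "\<exists>f'. (\<forall>v. real_polynomial_function (\<lambda>x. f' x v)) \<and> (\<forall>x. (f has_derivative f' x) (at x))"
  using assms
proof (induction rule: real_polynomial_function.induct)
  case (linear f)
  then show ?case
    by (intro exI[of _ "\<lambda>x. f"]) (auto simp: bounded_linear_imp_has_derivative)
next
  case (const c)
  then show ?case
    by (intro exI[of _ "\<lambda>x v. 0"]) auto
next
  case (add f g)
  then obtain f' g' where "\<forall>v. real_polynomial_function (\<lambda>x. f' x v)" "\<forall>x. (f has_derivative f' x) (at x)"
    "\<forall>v. real_polynomial_function (\<lambda>x. g' x v)" "\<forall>x. (g has_derivative g' x) (at x)" by auto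
  then show ?case
    by (intro exI[of _ "\<lambda>x v. f' x v + g' x v"]) (auto intro: has_derivative_add)
next
  case (mult f g)
  then obtain f' g' where "\<forall>v. real_polynomial_function (\<lambda>x. f' x v)" "\<forall>x. (f has_derivative f' x) (at x)"
    "\<forall>v. real_polynomial_function (\<lambda>x. g' x v)" "\<forall>x. (g has_derivative g' x) (at x)" by auto
  with mult.hyps show ?case
    by (intro exI[of _ "\<lambda>x v. f x * g' x v + f' x v * g x"] conjI allI has_derivative_mult
        real_polynomial_function.intros(3,4)) auto
qed

lemma polynomial_function_has_derivative:
  fixes f :: "'a::real_normed_vector \<Rightarrow> 'b::euclidean_space"
  assumes "polynomial_function f"
  shows "\<exists>f'. (\<forall>v. polynomial_function (\<lambda>x. f' x v)) \<and> (\<forall>x. (f has_derivative f' x) (at x))"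
proof -
  have "\<forall>b\<in>Basis. \<exists>f'. (\<forall>v. real_polynomial_function (\<lambda>x. f' x v)) \<and>
      (\<forall>x. ((\<lambda>x. f x \<bullet> b) has_derivative f' x) (at x))"
    using assms real_polynomial_function_has_derivative
    unfolding polynomial_function_iff_Basis_inner by blast
  then obtain f' where f': "\<And>b v. b \<in> Basis \<Longrightarrow> real_polynomial_function (\<lambda>x. f' b x v)"
    "\<And>b x. b \<in> Basis \<Longrightarrow> ((\<lambda>x. f x \<bullet> b) has_derivative f' b x) (at x)"
    unfolding bchoice_iff by blast
  define g where "g x v = (\<Sum>b\<in>Basis. f' b x v *\<^sub>R b)" for x v
  have "polynomial_function (\<lambda>x. g x v)" for v
    unfolding g_def using f'(1)
    by (intro polynomial_function_sum polynomial_function_mult) (auto simp: real_polynomial_function_eq)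
  moreover have "(f has_derivative g x) (at x)" for x
    unfolding has_derivative_componentwise_within[of f] using f'(2) by (simp add: g_def)
  ultimately show ?thesis by blast
qed

lemma smooth_in_polynomial:
  fixes f :: "'a::real_normed_vector \<Rightarrow> 'b::euclidean_space"
  assumes "polynomial_function f"
  shows "smooth_in V W f"
proof -
  have "Ck n V W f" for n
    using assms
  proof (induction n arbitrary: f)
    case 0
    then show ?case
      using polynomial_function_has_derivative has_derivative_continuous
      by (metis Ck.simps(1) continuous_at_imp_continuous_on)
  next
    case (Suc n)
    obtain f' where f': "\<And>v. polynomial_function (\<lambda>x. f' x v)" "\<And>x. (f has_derivative f' x) (at x)"
      using polynomial_function_has_derivative[OF Suc.prems] by blast
    have "f differentiable_on W"
      using f'(2) by (meson differentiableI differentiable_at_imp_differentiable_on)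
    then show ?case
      using Suc.IH[OF f'(1)] by (simp add: dirD_eq[OF f'(2)])
  qed
  then show ?thesis by (simp add: smooth_in_def)
qed

lemma polynomial_function_Pair [intro]:
  fixes f :: "'a::real_normed_vector \<Rightarrow> 'b::real_normed_vector"
    and g :: "'a \<Rightarrow> 'c::real_normed_vector"
  assumes "polynomial_function f" "polynomial_function g"
  shows "polynomial_function (\<lambda>x. (f x, g x))"
proof -
  have "bounded_linear (\<lambda>y. (y, 0::'c))" "bounded_linear (\<lambda>y. (0::'b, y))"
    by (auto intro!: bounded_linear_Pair bounded_linear_ident bounded_linear_zero)
  from this[THEN polynomial_function_bounded_linear]
  have "polynomial_function (\<lambda>x. (f x, 0::'c) + (0::'b, g x))"
    using polynomial_function_compose[OF assms(1)] polynomial_function_compose[OF assms(2)]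
    by (intro polynomial_function_add) (auto simp: o_def)
  then show ?thesis by simp
qed

text \<open>The quotient map is continuous by the choice of topology, so a compact set meeting every
  coset has the whole quotient as its compact image.\<close>

lemma compact_space_quot_top:
  assumes K: "compact K" "K \<subseteq> space_of X" and p: "proj X ` K = points X"
  shows "compact_space (quot_top X)"
proof -
  let ?L = "\<lambda>U. U \<subseteq> points X \<and> openin (top_of_set (space_of X)) {x \<in> space_of X. proj X x \<in> U}"
  have into: "proj X x \<in> points X" if "x \<in> space_of X" for x
    using that by (auto simp: proj_def points_def RCOSETS_def)
  \<comment> \<open>\<open>topology\<close> inverts \<open>openin\<close> only on predicates
    satisfying \<open>istopology\<close>; without this fact nothing is known about the open sets of
    \<open>quot_top X\<close>.\<close>
  have top: "istopology ?L"
    unfolding istopology_def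
  proof (intro conjI allI impI; (elim conjE)?)
    fix S T assume "openin (top_of_set (space_of X)) {x \<in> space_of X. proj X x \<in> S}"
      "openin (top_of_set (space_of X)) {x \<in> space_of X. proj X x \<in> T}"
    from openin_Int[OF this]
    show "openin (top_of_set (space_of X)) {x \<in> space_of X. proj X x \<in> S \<inter> T}"
      by (rule back_subst) auto
  next
    fix \<K> assume *: "\<forall>K\<in>\<K>. ?L K"
    then have "openin (top_of_set (space_of X)) (\<Union>K\<in>\<K>. {x \<in> space_of X. proj X x \<in> K})"
      by blast
    then show "openin (top_of_set (space_of X)) {x \<in> space_of X. proj X x \<in> \<Union>\<K>}"
      by (rule back_subst) auto
    show "\<Union>\<K> \<subseteq> points X" using * by blast
  qed auto
  have op: "openin (quot_top X) = ?L"
    unfolding quot_top_def by (rule topology_inverse'[OF top])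
  have "?L (points X)"
    using into by (auto simp: Collect_conj_eq cong: conj_cong intro: back_subst[of "openin _", OF openin_subtopology_self])
  then have tp: "topspace (quot_top X) = points X"
    by (metis op openin_subset openin_topspace subset_antisym)
  have "continuous_map (top_of_set (space_of X)) (quot_top X) (proj X)"
    unfolding continuous_map_def op tp using into by auto
  moreover have "compactin (top_of_set (space_of X)) K"
    using K by (simp add: compactin_subtopology)
  ultimately have "compactin (quot_top X) (points X)"
    using image_compactin p by metis
  then show ?thesis by (simp add: compact_space_def tp)
qed


lemma nlists_mem: "vs \<in> nlists k S \<Longrightarrow> v \<in> set vs \<Longrightarrow> v \<in> S"
  using nlistsE_set by (rule subsetD)

section \<open>Lifting forms and tangent vectors\<close>

text \<open>\<open>A g\<close> is the differential of the left translation by \<open>g\<close>; it does not depend on the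
  base point, which holds in exponential coordinates for groups of step at most \<open>2\<close>.\<close>

locale lattice_quotient =
  fixes X :: "('a::real_normed_vector) nilspace" and A :: "'a \<Rightarrow> 'a \<Rightarrow> 'a"
  assumes group_grp: "group (grp X)" and subspace_grp: "subspace (space_of X)"
    and subgroup_lat: "subgroup (lat X) (grp X)"
    and dirD_mult: "\<And>g x v. g \<in> space_of X \<Longrightarrow> x \<in> space_of X \<Longrightarrow> v \<in> space_of X \<Longrightarrow>
      dirD (\<lambda>y. g \<otimes>\<^bsub>grp X\<^esub> y) x v = A g v"
    and A_closed: "\<And>g v. g \<in> space_of X \<Longrightarrow> v \<in> space_of X \<Longrightarrow> A g v \<in> space_of X"
    and A_mult: "\<And>g h v. g \<in> space_of X \<Longrightarrow> h \<in> space_of X \<Longrightarrow> v \<in> space_of X \<Longrightarrow>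
      A (g \<otimes>\<^bsub>grp X\<^esub> h) v = A g (A h v)"
    and A_one: "\<And>v. v \<in> space_of X \<Longrightarrow> A \<one>\<^bsub>grp X\<^esub> v = v"
begin

sublocale group "grp X" by (rule group_grp)

abbreviation gmult (infixl "\<cdot>" 70) where "g \<cdot> h \<equiv> g \<otimes>\<^bsub>grp X\<^esub> h"

lemma lat_carrier: "l \<in> lat X \<Longrightarrow> l \<in> space_of X"
  using subgroup_lat by (rule subgroup.mem_carrier)

lemma proj_eq: "proj X x = (\<lambda>l. l \<cdot> x) ` lat X"
  by (auto simp: proj_def r_coset_def)

lemma mem_proj_self: "x \<in> space_of X \<Longrightarrow> x \<in> proj X x"
  unfolding proj_def using rcos_self subgroup_lat by blast

lemma proj_in_points: "x \<in> space_of X \<Longrightarrow> proj X x \<in> points X"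
  by (auto simp: proj_def points_def RCOSETS_def)

lemma proj_mult: "l \<in> lat X \<Longrightarrow> x \<in> space_of X \<Longrightarrow> proj X (l \<cdot> x) = proj X x"
  unfolding proj_def
  using repr_independence[of "l \<cdot> x" "lat X" x] subgroup_lat by (auto simp: r_coset_def)

lemma proj_eqD:
  assumes "x \<in> space_of X" "y \<in> space_of X" "proj X x = proj X y"
  obtains l where "l \<in> lat X" "x = l \<cdot> y"
  using mem_proj_self[OF assms(1)] assms(3) by (auto simp: proj_eq)

lemma dproj_eq:
  assumes "x \<in> space_of X" "v \<in> space_of X"
  shows "dproj X x v = (\<lambda>l. (l \<cdot> x, A l v)) ` lat X"
  unfolding dproj_def using assms dirD_mult lat_carrier by (intro image_cong) auto

lemma dproj_mult:
  assumes "l \<in> lat X" "x \<in> space_of X" "v \<in> space_of X"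
  shows "dproj X (l \<cdot> x) (A l v) = dproj X x v"
proof -
  have l: "l \<in> space_of X" using assms lat_carrier by blast
  have "dproj X (l \<cdot> x) (A l v) = (\<lambda>m. (m \<cdot> l \<cdot> x, A (m \<cdot> l) v)) ` lat X"
    using assms l lat_carrier by (subst dproj_eq) (auto simp: A_closed A_mult m_assoc)
  also have "\<dots> = (\<lambda>l. (l \<cdot> x, A l v)) ` (\<lambda>m. m \<cdot> l) ` lat X"
    by (simp add: image_image)
  also have "(\<lambda>m. m \<cdot> l) ` lat X = lat X"
    using coset_join2[OF l subgroup_lat assms(1)] by (auto simp: r_coset_def)
  finally show ?thesis using assms by (simp add: dproj_eq)
qed

text \<open>The lattice acts freely, so an orbit of tangent vectors contains exactly one vector over
  each point of the coset; this makes the \<open>THE\<close> in \<open>induced\<close>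
  meaningful.\<close>

lemma dproj_fibre:
  assumes "x \<in> space_of X" "v \<in> space_of X" "l \<in> lat X"
  shows "(THE w. (l \<cdot> x, w) \<in> dproj X x v) = A l v"
  using assms lat_carrier by (intro the_equality) (auto simp: dproj_eq)

text \<open>The representative chosen by \<open>SOME\<close> is an unknown lattice translate of
  \<open>x\<close>, and the vectors are carried along by \<open>A l\<close>. The same
  \<open>l\<close> serves all forms \<open>\<eta>\<close>.\<close>

lemma induced_apply:
  assumes x: "x \<in> space_of X" and vs: "set vs \<subseteq> space_of X"
  obtains l where "l \<in> lat X" "(SOME y. y \<in> proj X x) = l \<cdot> x"
    "\<And>\<eta>. induced \<eta> (proj X x) (map (dproj X x) vs) = \<eta> (l \<cdot> x) (map (A l) vs)"
proof -
  have "(SOME y. y \<in> proj X x) \<in> proj X x"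
    using mem_proj_self[OF x] by (rule someI)
  then obtain l where l: "l \<in> lat X" "(SOME y. y \<in> proj X x) = l \<cdot> x"
    by (auto simp: proj_eq)
  have "map (\<lambda>t. THE v. (l \<cdot> x, v) \<in> t) (map (dproj X x) vs) = map (A l) vs"
    using dproj_fibre[OF x _ l(1)] vs by auto
  then have "induced \<eta> (proj X x) (map (dproj X x) vs) = \<eta> (l \<cdot> x) (map (A l) vs)" for \<eta>
    unfolding induced_def Let_def l(2) by (rule arg_cong)
  with l show thesis by (rule that)
qed

text \<open>Left invariance undoes the unknown lattice translation left over by
  \<open>induced_apply\<close>.\<close>

lemma pull_induced:
  assumes inv: "left_invariant k (grp X) \<omega>" and x: "x \<in> space_of X" and vs: "vs \<in> nlists k (space_of X)"
  shows "pull X (induced \<omega>) x vs = \<omega> x vs"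
proof -
  have sub: "set vs \<subseteq> space_of X" using vs by simp
  obtain l where l: "l \<in> lat X" "pull X (induced \<omega>) x vs = \<omega> (l \<cdot> x) (map (A l) vs)"
    using induced_apply[OF x sub] unfolding pull_def by metis
  have "map (A l) vs = map (dirD (\<lambda>y. l \<cdot> y) x) vs"
    using sub l(1) x by (auto simp: dirD_mult lat_carrier)
  then show ?thesis
    using inv l x vs lat_carrier unfolding left_invariant_def by metis
qed

text \<open>Here \<open>x\<close> is the representative that \<^const>\<open>induced\<close> chooses, which is why the last clause
  holds for forms \<open>\<eta>\<close> that are not invariant.\<close>

lemma tangent_lift:
  assumes "p \<in> points X"
  obtains x where "x \<in> space_of X" "p = proj X x"
    "\<And>k ts. ts \<in> nlists k (tangent X p) \<Longrightarrow>
       \<exists>vs\<in>nlists k (space_of X). ts = map (dproj X x) vs \<and> (\<forall>\<eta>. induced \<eta> p ts = \<eta> x vs)"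
proof -
  obtain x0 where x0: "x0 \<in> space_of X" "p = proj X x0"
    using assms by (auto simp: points_def RCOSETS_def proj_def)
  define x where "x = (SOME y. y \<in> p)"
  have "x \<in> proj X x0"
    unfolding x_def x0(2) by (rule someI) (rule mem_proj_self[OF x0(1)])
  then have x: "x \<in> space_of X" "p = proj X x"
    using x0 lat_carrier proj_mult[OF _ x0(1)] by (auto simp: proj_eq[of x0])
  have lift: "\<exists>v\<in>space_of X. t = dproj X x v" if t: "t \<in> tangent X p" for t
  proof -
    obtain y v where y: "t = dproj X y v" "y \<in> p" "v \<in> space_of X"
      using t by (auto simp: tangent_def)
    then obtain l where l: "l \<in> lat X" "y = l \<cdot> x"
      using x by (auto simp: proj_eq)
    \<comment> \<open>The vector \<open>v\<close> sits over \<open>y\<close>, a lattice translate of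
      \<open>x\<close>; the inverse translation carries it to a vector over \<open>x\<close> in the
      same orbit.\<close>
    have li: "inv\<^bsub>grp X\<^esub> l \<in> lat X" using l subgroup_lat by (simp add: subgroup.m_inv_closed)
    have yc: "y \<in> space_of X" using l x lat_carrier by simp
    have "inv\<^bsub>grp X\<^esub> l \<cdot> y = x" using l x lat_carrier by (simp add: m_assoc[symmetric])
    then have "dproj X x (A (inv\<^bsub>grp X\<^esub> l) v) = t"
      using dproj_mult[OF li yc y(3)] y by simp
    then show ?thesis using y A_closed li lat_carrier by blast
  qed
  have "\<exists>vs\<in>nlists k (space_of X). ts = map (dproj X x) vs \<and> (\<forall>\<eta>. induced \<eta> p ts = \<eta> x vs)"
    if ts: "ts \<in> nlists k (tangent X p)" for k ts
  proof -
    have "\<forall>t\<in>set ts. \<exists>v. v \<in> space_of X \<and> t = dproj X x v"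
      using lift[OF nlists_mem[OF ts]] by blast
    then have "\<exists>w. \<forall>t\<in>set ts. w t \<in> space_of X \<and> t = dproj X x (w t)"
      by (rule bchoice)
    then obtain w where w: "\<And>t. t \<in> set ts \<Longrightarrow> w t \<in> space_of X" "\<And>t. t \<in> set ts \<Longrightarrow> dproj X x (w t) = t"
      by (metis (no_types))
    define vs where "vs = map w ts"
    have vs: "vs \<in> nlists k (space_of X)"
      using w(1) nlistsE_length[OF ts] by (intro nlistsI) (auto simp: vs_def)
    have tsvs: "ts = map (dproj X x) vs"
      unfolding vs_def map_map o_def by (rule map_idI[symmetric]) (rule w(2))
    have "induced \<eta> p ts = \<eta> x vs" for \<eta>
    proof -
      obtain l where l: "l \<in> lat X" "(SOME y. y \<in> proj X x) = l \<cdot> x"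
        and ind: "induced \<eta> (proj X x) (map (dproj X x) vs) = \<eta> (l \<cdot> x) (map (A l) vs)"
        using induced_apply[OF x(1) nlistsE_set[OF vs]] by blast
      \<comment> \<open>Since \<open>x\<close> is itself the chosen representative, the lattice
        element is forced to be the identity, and no invariance of \<open>\<eta>\<close>
        enters.\<close>
      have "l \<cdot> x = x" by (rule trans[OF l(2)[symmetric, folded x(2)] x_def[symmetric]])
      then have "l = \<one>\<^bsub>grp X\<^esub>" using l x lat_carrier r_cancel_one by metis
      moreover have "map (A \<one>\<^bsub>grp X\<^esub>) vs = vs"
        using A_one nlistsE_set[OF vs] by (intro map_idI) auto
      ultimately show ?thesis using ind x by (simp add: tsvs)
    qed
    with vs tsvs show ?thesis by blast
  qed
  with x show thesis by (rule that)
qed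

lemma extd_cong:
  assumes eq: "\<And>y us. y \<in> space_of X \<Longrightarrow> us \<in> nlists k (space_of X) \<Longrightarrow> \<omega> y us = \<eta> y us"
    and x: "x \<in> space_of X" and vs: "vs \<in> nlists (Suc k) (space_of X)"
  shows "extd \<omega> x vs = extd \<eta> x vs"
  unfolding extd_def
proof (intro sum.cong refl arg_cong2[where f = "(*)"] dirD_cong[OF subspace_grp x] eq)
  fix i assume i: "i \<in> {..<length vs}"
  show "vs ! i \<in> space_of X" using i vs by (auto intro: nlistsE_nth_in)
  show "take i vs @ drop (Suc i) vs \<in> nlists k (space_of X)"
    using vs i nlistsE_set[OF vs] by (intro nlistsI) (auto dest!: in_set_takeD in_set_dropD intro: nlists_mem)
qed

text \<open>\<open>nil_extd\<close> applies \<open>induced\<close> to an exterior derivative whose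
  own invariance is not established here. Evaluating at the representative from
  \<open>tangent_lift\<close> bypasses that question.\<close>

lemma nil_extd_induced:
  assumes inv: "left_invariant k (grp X) \<omega>" and "p \<in> points X"
  obtains x where "x \<in> space_of X" "p = proj X x"
    "\<And>ts. ts \<in> nlists (Suc k) (tangent X p) \<Longrightarrow>
       \<exists>vs\<in>nlists (Suc k) (space_of X). ts = map (dproj X x) vs \<and> nil_extd X (induced \<omega>) p ts = extd \<omega> x vs"
proof -
  obtain x where x: "x \<in> space_of X" "p = proj X x"
    and l: "\<And>k ts. ts \<in> nlists k (tangent X p) \<Longrightarrow>
       \<exists>vs\<in>nlists k (space_of X). ts = map (dproj X x) vs \<and> (\<forall>\<eta>. induced \<eta> p ts = \<eta> x vs)"
    using tangent_lift[OF assms(2)] by metis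
  have "extd (pull X (induced \<omega>)) x vs = extd \<omega> x vs" if "vs \<in> nlists (Suc k) (space_of X)" for vs
    using pull_induced[OF inv] x that by (intro extd_cong) auto
  with l x show thesis
    by (intro that[OF x]) (metis nil_extd_def)
qed

lemma nil_closed_induced:
  assumes "left_invariant k (grp X) \<omega>" "closed_form k (space_of X) \<omega>"
  shows "nil_closed k X (induced \<omega>)"
  unfolding nil_closed_def
proof (intro ballI)
  fix p ts assume "p \<in> points X" "ts \<in> nlists (Suc k) (tangent X p)"
  then show "nil_extd X (induced \<omega>) p ts = 0"
    using nil_extd_induced[OF assms(1), of p] assms(2) unfolding closed_form_def by metis
qed

lemma diff_form_cong:
  assumes "diff_form k (space_of X) \<omega>"
    and eq: "\<And>x vs. x \<in> space_of X \<Longrightarrow> vs \<in> nlists k (space_of X) \<Longrightarrow> \<omega> x vs = \<eta> x vs"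
  shows "diff_form k (space_of X) \<eta>"
proof -
  have up: "vs[i := u] \<in> nlists k (space_of X)"
    if "vs \<in> nlists k (space_of X)" "u \<in> space_of X" for vs i u
    using that set_update_subset_insert by (fastforce simp: nlists_def)
  have sub: "a *\<^sub>R u + b *\<^sub>R w \<in> space_of X" if "u \<in> space_of X" "w \<in> space_of X" for a b u w
    using that subspace_grp by (intro subspace_add subspace_scale)
  show ?thesis
    using assms(1) smooth_in_cong[OF subspace_grp, of "\<lambda>x. \<omega> x vs" "\<lambda>x. \<eta> x vs" for vs]
    unfolding diff_form_def by (auto simp: eq[symmetric] up sub)
qed

lemma invariant_form_induced:
  assumes "left_invariant k (grp X) \<omega>" "diff_form k (space_of X) \<omega>"
  shows "invariant_form k X (induced \<omega>)"
proof -
  have "map (dirD (\<lambda>y. g \<cdot> y) x) vs \<in> nlists k (space_of X)"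
    if "g \<in> space_of X" "x \<in> space_of X" "vs \<in> nlists k (space_of X)" for g x vs
    using that by (intro nlistsI) (auto simp: dirD_mult A_closed nlists_mem)
  then have "left_invariant k (grp X) (pull X (induced \<omega>))"
    using assms(1) unfolding left_invariant_def
    by (auto simp: pull_induced[OF assms(1)])
  moreover have "diff_form k (space_of X) (pull X (induced \<omega>))"
    using pull_induced[OF assms(1)] by (intro diff_form_cong[OF assms(2)]) auto
  ultimately show ?thesis by (simp add: invariant_form_def nil_form_def)
qed

end

section \<open>The Heisenberg group\<close>

lemma H3_simps [simp]:
  "carrier H3 = UNIV"
  "(x, y, z) \<otimes>\<^bsub>H3\<^esub> (x', y', z') = (x + x', y + y', z + z' + (x * y' - y * x') / 2)"
  "\<one>\<^bsub>H3\<^esub> = (0, 0, 0)"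
  by (simp_all add: H3_def)

lemma group_H3: "group H3"
proof (rule groupI)
  fix x assume "x \<in> carrier H3"
  obtain a b c where "x = (a, b, c)" by (cases x)
  then show "\<exists>y\<in>carrier H3. y \<otimes>\<^bsub>H3\<^esub> x = \<one>\<^bsub>H3\<^esub>"
    by (intro bexI[of _ "(-a, -b, -c)"]) auto
qed (auto simp: field_simps)

interpretation H3: group H3 by (rule group_H3)

lemma H3_inv [simp]: "inv\<^bsub>H3\<^esub> (x, y, z) = (-x, -y, -z)"
  by (rule H3.inv_equality) auto

definition heis_d :: "real \<times> real \<times> real \<Rightarrow> real \<times> real \<times> real \<Rightarrow> real \<times> real \<times> real" where
  "heis_d g v = (fst v, fst (snd v), snd (snd v) + (fst g * fst (snd v) - fst (snd g) * fst v) / 2)"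

lemma heis_d_simps [simp]: "heis_d (a, b, c) (u, v, w) = (u, v, w + (a * v - b * u) / 2)"
  by (simp add: heis_d_def)

lemma heis_d_mult: "heis_d (g \<otimes>\<^bsub>H3\<^esub> h) v = heis_d g (heis_d h v)"
  by (cases g; cases h; cases v) (simp add: field_simps)

text \<open>The product is affine in its second factor with linear part \<open>heis_d g\<close>, so
  the derivative is the same at every base point, as \<open>lattice_quotient\<close>
  demands.\<close>

lemma has_derivative_H3_mult: "((\<lambda>y. g \<otimes>\<^bsub>H3\<^esub> y) has_derivative heis_d g) (at x within S)"
proof -
  have "linear (heis_d g)"
    by (rule linearI) (auto simp: heis_d_def field_simps)
  then have "((\<lambda>y. g + heis_d g y) has_derivative (\<lambda>y. 0 + heis_d g y)) (at x within S)"
    by (intro has_derivative_add has_derivative_const bounded_linear_imp_has_derivative)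
      (simp add: linear_conv_bounded_linear)
  moreover have "g + heis_d g y = g \<otimes>\<^bsub>H3\<^esub> y" for y
    by (cases g; cases y) simp
  ultimately show ?thesis by simp
qed

lemma Lambda_iff:
  assumes "0 < k"
  shows "(x, y, z) \<in> Lambda k \<longleftrightarrow> x \<in> \<int> \<and> y \<in> \<int> \<and> 2 * real k * z \<in> \<int>"
  using assms by (auto simp: Lambda_def image_iff field_simps intro!: bexI[of _ "2 * real k * z"])

lemma subgroup_Lambda:
  assumes k: "0 < k"
  shows "subgroup (Lambda k) H3"
proof (rule H3.subgroupI)
  show "Lambda k \<noteq> {}" using Lambda_iff[OF k, of 0 0 0] by auto
  fix a b assume a: "a \<in> Lambda k" and b: "b \<in> Lambda k"
  obtain x y z where [simp]: "a = (x, y, z)" by (cases a)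
  obtain x' y' z' where [simp]: "b = (x', y', z')" by (cases b)
  show "inv\<^bsub>H3\<^esub> a \<in> Lambda k" using a by (simp add: Lambda_iff[OF k])
  \<comment> \<open>The 2 in the spacing \<open>1 / (2 k)\<close> cancels the 1/2 of the group law,
    so the twist contributes the integer \<open>k (x y' - y x')\<close>.\<close>
  have "2 * real k * z + 2 * real k * z' + real k * (x * y' - y * x') \<in> \<int>"
    using a b by (auto simp: Lambda_iff[OF k] intro!: Ints_add Ints_mult Ints_diff)
  also have "2 * real k * z + 2 * real k * z' + real k * (x * y' - y * x') =
      2 * real k * (z + z' + (x * y' - y * x') / 2)"
    by (simp add: field_simps)
  finally show "a \<otimes>\<^bsub>H3\<^esub> b \<in> Lambda k"
    using a b by (simp add: Lambda_iff[OF k])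
qed simp

lemma lattice_quotient_E:
  assumes "0 < k"
  shows "lattice_quotient (E k) heis_d"
  using group_H3 subgroup_Lambda[OF assms]
  by (intro lattice_quotient.intro)
    (auto simp: E_def heis_d_mult dirD_eq[OF has_derivative_H3_mult] simp del: H3_simps(2))

lemma uniform_discrete_Lambda:
  assumes k: "0 < k"
  shows "uniform_discrete (Lambda k)"
  unfolding uniform_discrete_def
\<comment> \<open>\<open>1 / (2 k)\<close> is the spacing in the central direction and at most the
  spacing 1 in the others; after rescaling, each pair of integer coordinates differs by less than
  1.\<close>
proof (intro exI[of _ "1 / (2 * real k)"] conjI ballI impI)
  fix a b assume ab: "a \<in> Lambda k" "b \<in> Lambda k" and d: "dist a b < 1 / (2 * real k)"
  obtain x y z where [simp]: "a = (x, y, z)" by (cases a)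
  obtain x' y' z' where [simp]: "b = (x', y', z')" by (cases b)
  have k1: "1 / (2 * real k) \<le> 1" "2 * real k > 0" using k by auto
  have "dist (snd a) (snd b) \<le> dist a b" "dist x x' \<le> dist a b"
    by (rule dist_snd_le) (use dist_fst_le[of a b] in simp)
  moreover have "dist y y' \<le> dist (snd a) (snd b)" "dist z z' \<le> dist (snd a) (snd b)"
    using dist_fst_le[of "snd a" "snd b"] dist_snd_le[of "snd a" "snd b"] by simp_all
  ultimately have "\<bar>x - x'\<bar> < 1" "\<bar>y - y'\<bar> < 1" "\<bar>z - z'\<bar> < 1 / (2 * real k)"
    using d k1 unfolding dist_real_def by linarith+
  moreover have "\<bar>2 * real k * z - 2 * real k * z'\<bar> = 2 * real k * \<bar>z - z'\<bar>"
    using k1(2) by (simp add: abs_mult flip: right_diff_distrib)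
  with calculation(3) have "\<bar>2 * real k * z - 2 * real k * z'\<bar> < 1"
    using k1(2) by (simp add: field_simps)
  ultimately have "x = x'" "y = y'" "2 * real k * z = 2 * real k * z'"
    using ab Ints_eq_abs_less1[of x x'] Ints_eq_abs_less1[of y y']
      Ints_eq_abs_less1[of "2 * real k * z" "2 * real k * z'"] by (simp_all add: Lambda_iff[OF k])
  then show "a = b" using k by simp
qed (use k in simp)

text \<open>Rounding \<open>x\<close> down to a multiple of \<open>1 / m\<close> leaves a remainder
  in \<open>[0, 1 / m]\<close>, which lies in \<open>[0, 1]\<close>. It serves with
  \<open>m = 1\<close> for the base coordinates and \<open>m = 2 k\<close> for the central
  one.\<close>

lemma translate_to_unit_interval: "\<exists>t::real. m * t \<in> \<int> \<and> 0 \<le> t + x \<and> t + x \<le> 1" if "1 \<le> m"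
proof -
  have "m * x - \<lfloor>m * x\<rfloor> \<in> {0..1}" by (auto simp: algebra_simps) linarith
  moreover have "x - \<lfloor>m * x\<rfloor> / m = (m * x - \<lfloor>m * x\<rfloor>) / m" using that by (simp add: field_simps)
  ultimately have "0 \<le> x - \<lfloor>m * x\<rfloor> / m" "x - \<lfloor>m * x\<rfloor> / m \<le> 1 / m" "1 / m \<le> 1"
    using that by (auto simp: divide_right_mono)
  moreover have "m * (- \<lfloor>m * x\<rfloor> / m) \<in> \<int>" using that by simp
  ultimately show ?thesis by (intro exI[of _ "- \<lfloor>m * x\<rfloor> / m"]) auto
qed

lemma compact_space_E:
  assumes k: "0 < k"
  shows "compact_space (quot_top (E k))"
proof (rule compact_space_quot_top)
  interpret E: lattice_quotient "E k" heis_d by (rule lattice_quotient_E[OF k])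
  let ?K = "{0..1} \<times> {0..1} \<times> {0..1::real} :: (real \<times> real \<times> real) set"
  show "compact ?K" by (intro compact_Times) auto
  show "?K \<subseteq> space_of (E k)" by (simp add: E_def)
  show "proj (E k) ` ?K = points (E k)"
  proof (intro subset_antisym subsetI)
    fix p assume "p \<in> points (E k)"
    then obtain x y z where p: "p = proj (E k) (x, y, z)"
      by (auto simp: points_def RCOSETS_def proj_def)
    obtain a where a: "a \<in> \<int>" "0 \<le> a + x" "a + x \<le> 1"
      using translate_to_unit_interval[of 1 x] by auto
    obtain b where b: "b \<in> \<int>" "0 \<le> b + y" "b + y \<le> 1"
      using translate_to_unit_interval[of 1 y] by auto
    \<comment> \<open>\<open>c\<close> is chosen after \<open>a\<close> and \<open>b\<close>,
      because it must also compensate the twist that they cause in the third coordinate.\<close>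
    obtain c where c: "2 * real k * c \<in> \<int>" "0 \<le> c + (z + (a * y - b * x) / 2)" "c + (z + (a * y - b * x) / 2) \<le> 1"
      using translate_to_unit_interval[of "2 * real k" "z + (a * y - b * x) / 2"] k by auto
    have "(a, b, c) \<in> Lambda k" using a b c Lambda_iff[OF k] by simp
    then have "p = proj (E k) ((a, b, c) \<otimes>\<^bsub>H3\<^esub> (x, y, z))"
      using E.proj_mult[of "(a, b, c)" "(x, y, z)"] p by (simp add: E_def)
    moreover have "(a, b, c) \<otimes>\<^bsub>H3\<^esub> (x, y, z) \<in> ?K" using a b c by simp
    ultimately show "p \<in> proj (E k) ` ?K" by (rule image_eqI)
  qed (use E.proj_in_points in \<open>auto simp: E_def\<close>)
qed

lemma polynomial_function_fst [intro]:
  "polynomial_function (\<lambda>x. fst (f x))" and polynomial_function_snd [intro]: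
  "polynomial_function (\<lambda>x. snd (f x))" if "polynomial_function f"
  using polynomial_function_compose[OF that polynomial_function_bounded_linear[OF bounded_linear_fst]]
    polynomial_function_compose[OF that polynomial_function_bounded_linear[OF bounded_linear_snd]]
  by (simp_all add: o_def)

lemma nilpotent_lie_group_H3: "nilpotent_lie_group H3"
  unfolding nilpotent_lie_group_def
proof (intro conjI)
  show "group H3" by (rule group_H3)
  have "polynomial_function (\<lambda>p::(real \<times> real \<times> real) \<times> (real \<times> real \<times> real).
     (fst (fst p) + fst (snd p), fst (snd (fst p)) + fst (snd (snd p)),
      snd (snd (fst p)) + snd (snd (snd p)) +
      (1/2) *\<^sub>R (fst (fst p) *\<^sub>R fst (snd (snd p)) - fst (snd (fst p)) *\<^sub>R fst (snd p))))"
    by (intro polynomial_function_Pair polynomial_function_add polynomial_function_diff polynomial_function_cmul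
        polynomial_function_mult polynomial_function_fst polynomial_function_snd polynomial_function_id)
  then show "smooth_in (carrier H3 \<times> carrier H3) (carrier H3 \<times> carrier H3) (\<lambda>(x, y). x \<otimes>\<^bsub>H3\<^esub> y)"
    by (intro smooth_in_polynomial) (rule back_subst[of polynomial_function], auto simp: fun_eq_iff)
  have "polynomial_function (\<lambda>p::real \<times> real \<times> real. - p)"
    by (intro polynomial_function_minus polynomial_function_id)
  then show "smooth_in (carrier H3) (carrier H3) (\<lambda>x. inv\<^bsub>H3\<^esub> x)"
    by (intro smooth_in_polynomial) (rule back_subst[of polynomial_function], auto simp: fun_eq_iff)
  \<comment> \<open>A commutator is \<open>(0, 0, x y' - y x')\<close>, hence central; commutators
    with central elements are trivial, so the series stops one term later.\<close>
  have l1: "lower_central H3 1 \<subseteq> {(0, 0, z) | z. True}"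
  proof
    fix x assume "x \<in> lower_central H3 1"
    then have "x \<in> generate H3 {g \<otimes>\<^bsub>H3\<^esub> h \<otimes>\<^bsub>H3\<^esub> inv\<^bsub>H3\<^esub> g \<otimes>\<^bsub>H3\<^esub> inv\<^bsub>H3\<^esub> h | g h. True}"
      by simp
    then show "x \<in> {(0, 0, z) | z. True}"
      by (induction rule: generate.induct) auto
  qed
  have "lower_central H3 2 \<subseteq> {\<one>\<^bsub>H3\<^esub>}"
  proof
    fix x assume "x \<in> lower_central H3 2"
    then have "x \<in> generate H3 {g \<otimes>\<^bsub>H3\<^esub> h \<otimes>\<^bsub>H3\<^esub> inv\<^bsub>H3\<^esub> g \<otimes>\<^bsub>H3\<^esub> inv\<^bsub>H3\<^esub> h | g h. h \<in> lower_central H3 1}"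
      by (simp add: numeral_2_eq_2)
    then show "x \<in> {\<one>\<^bsub>H3\<^esub>}"
      by (induction rule: generate.induct) (use l1 in fastforce)+
  qed
  moreover have "\<one>\<^bsub>H3\<^esub> \<in> lower_central H3 2"
    by (simp add: numeral_2_eq_2 generate.one del: H3_simps)
  ultimately show "\<exists>n. lower_central H3 n = {\<one>\<^bsub>H3\<^esub>}" by blast
qed (auto simp: field_simps)

lemma nilmanifold_E: "0 < k \<Longrightarrow> nilmanifold (E k)"
  using nilpotent_lie_group_H3 subgroup_Lambda compact_space_E
    uniform_discrete_imp_discrete[OF uniform_discrete_Lambda]
  by (simp add: nilmanifold_def E_def)

section \<open>The base torus and the circle bundles over it\<close>

lemma group_T2: "group (grp T2)"
proof (rule groupI)
  fix x assume "x \<in> carrier (grp T2)"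
  then show "\<exists>y\<in>carrier (grp T2). y \<otimes>\<^bsub>grp T2\<^esub> x = \<one>\<^bsub>grp T2\<^esub>"
    by (intro bexI[of _ "- x"]) (auto simp: T2_def)
qed (auto simp: T2_def)

lemma nilmanifold_T2: "nilmanifold T2"
proof -
  interpret T: group "grp T2" by (rule group_T2)
  have [simp]: "carrier (grp T2) = UNIV" "mult (grp T2) = (+)" "\<one>\<^bsub>grp T2\<^esub> = 0" "lat T2 = \<int> \<times> \<int>"
    by (simp_all add: T2_def)
  have [simp]: "m_inv (grp T2) = uminus"
    by (rule ext, rule T.inv_equality) auto
  have "lower_central (grp T2) 1 \<subseteq> {0}"
  proof
    fix x assume "x \<in> lower_central (grp T2) 1"
    then have "x \<in> generate (grp T2) {0}" by simp
    then show "x \<in> {0}" by (induction rule: generate.induct) auto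
  qed
  moreover have "0 \<in> lower_central (grp T2) 1"
    using generate.one[of "grp T2"] by simp
  ultimately have lc: "\<exists>n. lower_central (grp T2) n = {\<one>\<^bsub>grp T2\<^esub>}"
    by (intro exI[of _ 1]) auto
  have "polynomial_function (\<lambda>p::(real \<times> real) \<times> (real \<times> real). fst p + snd p)"
    "polynomial_function (\<lambda>p::real \<times> real. - p)"
    by (intro polynomial_function_add polynomial_function_minus polynomial_function_fst polynomial_function_snd
        polynomial_function_id)+
  then have "smooth_in UNIV UNIV (\<lambda>(x, y). x + y :: real \<times> real)" "smooth_in UNIV UNIV (\<lambda>x. - x :: real \<times> real)"
    by (auto simp: case_prod_beta' intro!: smooth_in_polynomial)
  then have lie: "nilpotent_lie_group (grp T2)"
    using lc group_T2 unfolding nilpotent_lie_group_def by (simp add: scaleR_left_distrib)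
  have sub: "subgroup (lat T2) (grp T2)"
    by (rule T.subgroupI) auto
  have "uniform_discrete (\<int> \<times> \<int> :: (real \<times> real) set)"
    unfolding uniform_discrete_def
  proof (intro exI[of _ 1] conjI ballI impI)
    fix a b :: "real \<times> real" assume ab: "a \<in> \<int> \<times> \<int>" "b \<in> \<int> \<times> \<int>" and d: "dist a b < 1"
    then have "\<bar>fst a - fst b\<bar> < 1" "\<bar>snd a - snd b\<bar> < 1"
      using dist_fst_le[of a b] dist_snd_le[of a b] by (auto simp: dist_real_def)
    with ab show "a = b" by (auto simp: prod_eq_iff intro!: Ints_eq_abs_less1[THEN iffD2])
  qed simp
  then have disc: "discrete (lat T2)" by (simp add: uniform_discrete_imp_discrete)
  have "compact_space (quot_top T2)"
  proof (rule compact_space_quot_top)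
    let ?K = "{0..1} \<times> {0..1::real} :: (real \<times> real) set"
    show "compact ?K" by (intro compact_Times) auto
    show "?K \<subseteq> space_of T2" by simp
    show "proj T2 ` ?K = points T2"
    proof (intro subset_antisym subsetI)
      fix p assume "p \<in> points T2"
      then obtain x y where p: "p = proj T2 (x, y)"
        by (auto simp: points_def RCOSETS_def proj_def)
      obtain a where a: "a \<in> \<int>" "0 \<le> a + x" "a + x \<le> 1"
        using translate_to_unit_interval[of 1 x] by auto
      obtain b where b: "b \<in> \<int>" "0 \<le> b + y" "b + y \<le> 1"
        using translate_to_unit_interval[of 1 y] by auto
      have "(a, b) + (x, y) \<in> lat T2 #>\<^bsub>grp T2\<^esub> (x, y)"
        using a b by (auto simp: r_coset_def)
      then have "p = proj T2 ((a, b) + (x, y))"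
        using T.repr_independence[OF _ _ sub, of "(a, b) + (x, y)" "(x, y)"] p by (simp add: proj_def)
      moreover have "(a, b) + (x, y) \<in> ?K" using a b by simp
      ultimately show "p \<in> proj T2 ` ?K" by (rule image_eqI)
    qed (auto simp: points_def RCOSETS_def proj_def)
  qed
  with lie sub disc show ?thesis by (simp add: nilmanifold_def)
qed

lemma principal_torus_bundle_E:
  assumes k: "0 < k"
  shows "principal_torus_bundle (E_bundle k)"
proof -
  define q :: "real \<times> real \<times> real \<Rightarrow> real \<times> real" where "q = (\<lambda>(x, y, z). (x, y))"
  have ker: "kernel H3 (grp T2) q = {0} \<times> {0} \<times> UNIV"
    by (auto simp: kernel_def T2_def q_def zero_prod_def)
  have E: "total_space (E_bundle k) = E k" "base_space (E_bundle k) = T2" "hmap (E_bundle k) = q"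
    by (simp_all add: E_bundle_def q_def)
  have fib: "fibre (E_bundle k) = \<lparr>grp = H3\<lparr>carrier := {0} \<times> {0} \<times> UNIV\<rparr>, lat = Lambda k \<inter> ({0} \<times> {0} \<times> UNIV)\<rparr>"
    unfolding fibre_def Let_def E ker[symmetric] by (simp add: E_def)
  have "polynomial_function q"
    unfolding q_def case_prod_beta'
    by (intro polynomial_function_Pair polynomial_function_fst polynomial_function_snd polynomial_function_id)
  then have sm: "smooth_in (space_of (E k)) (space_of (E k)) q"
    by (rule smooth_in_polynomial)
  have hom: "q \<in> hom (grp (E k)) (grp T2)"
    by (auto simp: hom_def E_def T2_def q_def)
  have surj: "q ` space_of (E k) = space_of T2"
    by (force simp: E_def T2_def q_def image_iff)
  have "(x, y) \<in> q ` Lambda k" if "x \<in> \<int>" "y \<in> \<int>" for x y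
    using that by (intro image_eqI[of _ _ "(x, y, 0)"]) (auto simp: Lambda_iff[OF k] q_def)
  then have lat: "q ` lat (E k) = lat T2"
    by (auto simp: E_def T2_def q_def Lambda_def)
  have con: "connected (space_of (fibre (E_bundle k)))"
    unfolding fib by (simp add: connected_Times)
  have cpt: "compact_space (quot_top (fibre (E_bundle k)))"
  proof (rule compact_space_quot_top)
    let ?K = "{0} \<times> {0} \<times> {0..1::real} :: (real \<times> real \<times> real) set"
    show "compact ?K" by (intro compact_Times) auto
    show "?K \<subseteq> space_of (fibre (E_bundle k))" by (auto simp: fib)
    show "proj (fibre (E_bundle k)) ` ?K = points (fibre (E_bundle k))"
    proof (intro subset_antisym subsetI)
      fix p assume "p \<in> points (fibre (E_bundle k))"
      then obtain z where p: "p = (\<lambda>l. l \<otimes>\<^bsub>H3\<^esub> (0, 0, z)) ` (Lambda k \<inter> ({0} \<times> {0} \<times> UNIV))"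
        by (auto simp: points_def RCOSETS_def r_coset_def fib)
      obtain c where c: "2 * real k * c \<in> \<int>" "0 \<le> c + z" "c + z \<le> 1"
        using translate_to_unit_interval[of "2 * real k" z] k by auto
      \<comment> \<open>Translating the representative by the lattice element
        \<open>(0, 0, c)\<close> only reindexes the coset, by \<open>d - c\<close> in one direction
        and \<open>d + c\<close> in the other.\<close>
      have "p = (\<lambda>l. l \<otimes>\<^bsub>H3\<^esub> (0, 0, c + z)) ` (Lambda k \<inter> ({0} \<times> {0} \<times> UNIV))"
        unfolding p
      proof (intro subset_antisym subsetI)
        fix u assume "u \<in> (\<lambda>l. l \<otimes>\<^bsub>H3\<^esub> (0, 0, z)) ` (Lambda k \<inter> ({0} \<times> {0} \<times> UNIV))"
        then obtain d where "(0, 0, d) \<in> Lambda k" "u = (0, 0, d + z)" by auto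
        then show "u \<in> (\<lambda>l. l \<otimes>\<^bsub>H3\<^esub> (0, 0, c + z)) ` (Lambda k \<inter> ({0} \<times> {0} \<times> UNIV))"
          using c by (intro image_eqI[of _ _ "(0, 0, d - c)"]) (auto simp: Lambda_iff[OF k] right_diff_distrib)
      next
        fix u assume "u \<in> (\<lambda>l. l \<otimes>\<^bsub>H3\<^esub> (0, 0, c + z)) ` (Lambda k \<inter> ({0} \<times> {0} \<times> UNIV))"
        then obtain d where "(0, 0, d) \<in> Lambda k" "u = (0, 0, d + c + z)" by auto
        then show "u \<in> (\<lambda>l. l \<otimes>\<^bsub>H3\<^esub> (0, 0, z)) ` (Lambda k \<inter> ({0} \<times> {0} \<times> UNIV))"
          using c by (intro image_eqI[of _ _ "(0, 0, d + c)"]) (auto simp: Lambda_iff[OF k] distrib_left)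
      qed
      then have "p = proj (fibre (E_bundle k)) (0, 0, c + z)"
        by (auto simp: proj_def r_coset_def fib)
      with c show "p \<in> proj (fibre (E_bundle k)) ` ?K" by auto
    qed (auto simp: points_def RCOSETS_def proj_def fib)
  qed
  show ?thesis
    unfolding principal_torus_bundle_def E
    using nilmanifold_E[OF k] nilmanifold_T2 hom sm surj lat con cpt
    by (auto simp: fib) (auto simp: E_def)
qed

section \<open>T-duality\<close>

lemma Pair_eq_zero_iff: "(a, b) = 0 \<longleftrightarrow> a = 0 \<and> b = 0"
  by (simp add: zero_prod_def)

section \<open>Invariant 3-forms on \<open>H3\<close> as multiples of the determinant\<close>

definition det3 :: "real \<times> real \<times> real \<Rightarrow> real \<times> real \<times> real \<Rightarrow> real \<times> real \<times> real \<Rightarrow> real" where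
  "det3 = (\<lambda>(a, b, c) (a', b', c') (a'', b'', c'').
     a * (b' * c'' - c' * b'') - b * (a' * c'' - c' * a'') + c * (a' * b'' - b' * a''))"

text \<open>At a fixed point this is the fact that alternating trilinear forms on a 3-dimensional
  space are multiples of the determinant; the coefficient may still depend on
  \<open>x\<close>.\<close>

lemma three_form_eq_det3:
  fixes H :: "(real \<times> real \<times> real) form"
  assumes "diff_form 3 UNIV H"
  shows "H x [u, v, w] = H x [(1, 0, 0), (0, 1, 0), (0, 0, 1)] * det3 u v w"
proof -
  define T where "T u v w = H x [u, v, w]" for u v w
  have lin: "H x (vs[i := a *\<^sub>R u + b *\<^sub>R w]) = a * H x (vs[i := u]) + b * H x (vs[i := w])"
    if "vs \<in> nlists 3 UNIV" "i < 3" for vs i a u b w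
    using assms that unfolding diff_form_def by blast
  have alt: "H x vs = 0" if "vs \<in> nlists 3 UNIV" "\<not> distinct vs" for vs
    using assms that unfolding diff_form_def by blast
  have lin3: "T (a *\<^sub>R u + b *\<^sub>R u') v w = a * T u v w + b * T u' v w"
    "T v (a *\<^sub>R u + b *\<^sub>R u') w = a * T v u w + b * T v u' w"
    "T v w (a *\<^sub>R u + b *\<^sub>R u') = a * T v w u + b * T v w u'" for a b u u' v w
    using lin[of "[0, v, w]" 0 a u b u'] lin[of "[v, 0, w]" 1 a u b u'] lin[of "[v, w, 0]" 2 a u b u']
    by (simp_all add: T_def in_nlists_UNIV)
  have add: "T (u + u') v w = T u v w + T u' v w" "T v (u + u') w = T v u w + T v u' w"
    "T v w (u + u') = T v w u + T v w u'" for u u' v w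
    using lin3[where a = 1 and u = u and b = 1 and u' = u'] by simp_all
  have scale: "T (a *\<^sub>R u) v w = a * T u v w" "T v (a *\<^sub>R u) w = a * T v u w"
    "T v w (a *\<^sub>R u) = a * T v w u" for a u v w
    using lin3[where a = a and u = u and b = 0 and u' = 0] by simp_all
  have zero: "T u u v = 0" "T u v u = 0" "T v u u = 0" for u v
    using alt by (simp_all add: T_def in_nlists_UNIV)
  \<comment> \<open>Polarisation: \<open>diff_form\<close> only says that repeated arguments give 0,
    and expanding this at \<open>u + v\<close> yields antisymmetry.\<close>
  have swap: "T u v w = - T v u w" "T w u v = - T w v u" for u v w
    using zero(1)[of "u + v" w, unfolded add] zero(3)[of w "u + v", unfolded add] unfolding zero by simp_all
  define e1 e2 e3 :: "real \<times> real \<times> real" where "e1 = (1, 0, 0)" and "e2 = (0, 1, 0)" and "e3 = (0, 0, 1)"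
  have perm: "T e2 e1 e3 = - T e1 e2 e3" "T e1 e3 e2 = - T e1 e2 e3" "T e3 e1 e2 = T e1 e2 e3"
    "T e2 e3 e1 = T e1 e2 e3" "T e3 e2 e1 = - T e1 e2 e3"
    using swap(1)[of e2 e1 e3] swap(2)[of e1 e3 e2] swap(1)[of e3 e1 e2] swap(2)[of e2 e3 e1]
      swap(1)[of e3 e2 e1] by simp_all
  obtain a b c where u: "u = (a, b, c)" by (cases u)
  obtain a' b' c' where v: "v = (a', b', c')" by (cases v)
  obtain a'' b'' c'' where w: "w = (a'', b'', c'')" by (cases w)
  have e: "(a, b, c) = a *\<^sub>R e1 + b *\<^sub>R e2 + c *\<^sub>R e3" for a b c
    by (simp add: e1_def e2_def e3_def)
  have "T u v w = T e1 e2 e3 * det3 u v w"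
    unfolding det3_def u v w prod.case by (simp only: e add scale zero perm) algebra
  then show ?thesis by (simp add: T_def e1_def e2_def e3_def)
qed

text \<open>Translation from the origin to \<open>x\<close> changes the standard frame only by
  central components, so its determinant stays 1 and the coefficient at \<open>x\<close> equals that
  at the origin.\<close>

lemma invariant_three_form_eq:
  assumes "diff_form 3 (carrier H3) H" and "left_invariant 3 H3 H"
  obtains c where "\<And>x u v w. H x [u, v, w] = c * det3 u v w"
proof
  let ?e = "[(1, 0, 0), (0, 1, 0), (0, 0, 1)] :: (real \<times> real \<times> real) list"
  have df: "diff_form 3 UNIV H" using assms(1) by simp
  fix x :: "real \<times> real \<times> real" and u v w
  obtain a b d where x: "x = (a, b, d)" by (cases x)
  have "?e \<in> nlists 3 (carrier H3)" by (simp add: in_nlists_UNIV)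
  then have "H (x \<otimes>\<^bsub>H3\<^esub> (0, 0, 0)) (map (dirD (\<lambda>y. x \<otimes>\<^bsub>H3\<^esub> y) (0, 0, 0)) ?e) = H (0, 0, 0) ?e"
    using assms(2) unfolding left_invariant_def H3_simps(1) by (metis UNIV_I)
  then have "H x [(1, 0, - b / 2), (0, 1, a / 2), (0, 0, 1)] = H (0, 0, 0) ?e"
    by (simp add: dirD_eq[OF has_derivative_H3_mult] del: H3_simps(2)) (simp add: x)
  then have "H x ?e = H (0, 0, 0) ?e"
    by (subst (asm) three_form_eq_det3[OF df]) (simp add: det3_def)
  then show "H x [u, v, w] = H (0, 0, 0) ?e * det3 u v w"
    using three_form_eq_det3[OF df, of x u v w] by simp
qed

text \<open>\<open>contact\<close> is the left-invariant form \<open>\<theta> = dz - (x dy - y dx) / 2\<close>, \<open>area\<close> is \<open>dx \<and> dy = - d\<theta>\<close>, and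
  \<open>poincare c\<close> is \<open>c \<theta> \<and> \<theta>'\<close> on the fibre product.\<close>

definition contact :: "real \<times> real \<times> real \<Rightarrow> real \<times> real \<times> real \<Rightarrow> real" where
  "contact x v = snd (snd v) - (fst x * fst (snd v) - fst (snd x) * fst v) / 2"

lemma contact_invariant: "contact (g \<otimes>\<^bsub>H3\<^esub> x) (heis_d g v) = contact x v"
  by (cases g; cases x; cases v) (simp add: contact_def field_simps)

lemma contact_linear: "contact x (a *\<^sub>R u + b *\<^sub>R v) = a * contact x u + b * contact x v"
  by (simp add: contact_def field_simps)

definition area :: "real \<times> real \<times> real \<Rightarrow> real \<times> real \<times> real \<Rightarrow> real" where
  "area u v = fst u * fst (snd v) - fst (snd u) * fst v"

text \<open>\<open>contact\<close> is affine in the base point with slope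
  \<open>- area u v / 2\<close> along \<open>u\<close>; antisymmetrising in \<open>u\<close> and
  \<open>v\<close> gives d\<theta> = - dx \<and> dy.\<close>

lemma contact_line: "contact (x + t *\<^sub>R u) v = contact x v - t * area u v / 2"
  by (simp add: contact_def area_def field_simps)

definition poincare :: "real \<Rightarrow> ((real \<times> real \<times> real) \<times> (real \<times> real \<times> real)) form" where
  "poincare c x vs = c * (contact (fst x) (fst (vs ! 0)) * contact (snd x) (snd (vs ! 1)) -
     contact (fst x) (fst (vs ! 1)) * contact (snd x) (snd (vs ! 0)))"

lemma diff_form_poincare: "diff_form 2 V (poincare c)"
  unfolding diff_form_def
proof (intro conjI ballI allI impI)
  fix x vs i u w and a b :: real assume vs: "vs \<in> nlists 2 V" "i < (2::nat)"
  then obtain v0 v1 where [simp]: "vs = [v0, v1]"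
    by (auto simp: in_nlists_Suc_iff numeral_2_eq_2)
  from vs(2) consider "i = 0" | "i = 1" by linarith
  then show "poincare c x (vs[i := a *\<^sub>R u + b *\<^sub>R w]) = a * poincare c x (vs[i := u]) + b * poincare c x (vs[i := w])"
    by cases (simp_all add: poincare_def contact_linear algebra_simps)
next
  fix x and vs assume "vs \<in> nlists 2 V" "\<not> distinct vs"
  then show "poincare c x vs = 0"
    by (auto simp: in_nlists_Suc_iff numeral_2_eq_2 poincare_def)
next
  fix vs
  have contact: "polynomial_function (\<lambda>x. contact (f x) v)" if "polynomial_function f"
    for f :: "(real \<times> real \<times> real) \<times> (real \<times> real \<times> real) \<Rightarrow> _" and v
  proof -
    have "polynomial_function (\<lambda>x. snd (snd v) - (1/2) *\<^sub>R (fst (f x) *\<^sub>R fst (snd v) - fst (snd (f x)) *\<^sub>R fst v))"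
      by (intro polynomial_function_diff polynomial_function_cmul polynomial_function_mult polynomial_function_const
          polynomial_function_fst polynomial_function_snd that)
    then show ?thesis by (simp add: contact_def)
  qed
  have "polynomial_function (\<lambda>x. c *\<^sub>R (contact (fst x) (fst (vs ! 0)) *\<^sub>R contact (snd x) (snd (vs ! 1)) -
     contact (fst x) (fst (vs ! 1)) *\<^sub>R contact (snd x) (snd (vs ! 0))))"
    by (intro polynomial_function_diff polynomial_function_cmul polynomial_function_mult contact
        polynomial_function_fst polynomial_function_snd polynomial_function_id)
  then show "smooth_in V V (\<lambda>x. poincare c x vs)"
    unfolding poincare_def by (intro smooth_in_polynomial) simp
qed

lemma dirD_poincare:
  "dirD (\<lambda>y. poincare c y [u, v]) x w = c / 2 *
     (area (fst w) (fst v) * contact (snd x) (snd u) + area (snd w) (snd u) * contact (fst x) (fst v) -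
      area (fst w) (fst u) * contact (snd x) (snd v) - area (snd w) (snd v) * contact (fst x) (fst u))"
  unfolding dirD_def poincare_def
  by (rule vector_derivative_at, unfold has_real_derivative_iff_has_vector_derivative[symmetric])
    (auto simp: contact_line field_simps intro!: derivative_eq_intros)

text \<open>The hypotheses put the point and the vectors into the fibre product, where both factors
  share their first two coordinates. So the two area forms coincide, and the terms
  \<open>x dy - y dx\<close> cancel in \<theta> - \<theta>', which leaves dz - dz'.\<close>

lemma extd_poincare:
  assumes "fst (fst x) = fst (snd x)" "fst (snd (fst x)) = fst (snd (snd x))"
    and vs: "\<And>v. v \<in> {v0, v1, v2} \<Longrightarrow> fst (fst v) = fst (snd v) \<and> fst (snd (fst v)) = fst (snd (snd v))"
  shows "extd (poincare c) x [v0, v1, v2] =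
    c * det3 (fst v0) (fst v1) (fst v2) - c * det3 (snd v0) (snd v1) (snd v2)"
proof -
  obtain a b z z' where x: "x = ((a, b, z), (a, b, z'))"
    using assms(1,2) by (cases x) auto
  obtain a0 b0 c0 d0 where v0: "v0 = ((a0, b0, c0), (a0, b0, d0))"
    using vs[of v0] by (cases v0) auto
  obtain a1 b1 c1 d1 where v1: "v1 = ((a1, b1, c1), (a1, b1, d1))"
    using vs[of v1] by (cases v1) auto
  obtain a2 b2 c2 d2 where v2: "v2 = ((a2, b2, c2), (a2, b2, d2))"
    using vs[of v2] by (cases v2) auto
  have "extd (poincare c) x [v0, v1, v2] =
      dirD (\<lambda>y. poincare c y [v1, v2]) x v0 - dirD (\<lambda>y. poincare c y [v0, v2]) x v1 +
      dirD (\<lambda>y. poincare c y [v0, v1]) x v2"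
    by (simp add: extd_def lessThan_Suc numeral_3_eq_3)
  then show ?thesis
    unfolding dirD_poincare by (simp add: x v0 v1 v2 area_def contact_def det3_def field_simps)
qed

section \<open>The fibre product of two bundles as a lattice quotient\<close>

definition prod_d :: "(real \<times> real \<times> real) \<times> (real \<times> real \<times> real) \<Rightarrow>
    (real \<times> real \<times> real) \<times> (real \<times> real \<times> real) \<Rightarrow> (real \<times> real \<times> real) \<times> (real \<times> real \<times> real)" where
  "prod_d g v = (heis_d (fst g) (fst v), heis_d (snd g) (snd v))"

context
  fixes j k :: nat
begin

abbreviation corr :: "((real \<times> real \<times> real) \<times> (real \<times> real \<times> real)) nilspace" where
  "corr \<equiv> fibre_product (E_bundle k) (E_bundle j)"

lemma corr_simps:
  "space_of corr = {((x, y, z), (x, y, z')) | x y z z'. True}"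
  "g \<otimes>\<^bsub>grp corr\<^esub> h = (fst g \<otimes>\<^bsub>H3\<^esub> fst h, snd g \<otimes>\<^bsub>H3\<^esub> snd h)"
  "\<one>\<^bsub>grp corr\<^esub> = ((0, 0, 0), (0, 0, 0))"
  "lat corr = {((x, y, z), (x, y, z')) | x y z z'. (x, y, z) \<in> Lambda k \<and> (x, y, z') \<in> Lambda j}"
  by (auto simp: fibre_product_def E_bundle_def E_def DirProd_def split: prod.splits)

lemma group_corr: "group (grp corr)"
proof (rule groupI)
  fix a assume "a \<in> space_of corr"
  then obtain x y z z' where "a = ((x, y, z), (x, y, z'))" by (auto simp: corr_simps)
  then show "\<exists>b\<in>space_of corr. b \<otimes>\<^bsub>grp corr\<^esub> a = \<one>\<^bsub>grp corr\<^esub>"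
    by (intro bexI[of _ "((-x, -y, -z), (-x, -y, -z'))"]) (auto simp: corr_simps)
next
  fix a b c assume "a \<in> space_of corr" "b \<in> space_of corr" "c \<in> space_of corr"
  then show "a \<otimes>\<^bsub>grp corr\<^esub> b \<otimes>\<^bsub>grp corr\<^esub> c = a \<otimes>\<^bsub>grp corr\<^esub> (b \<otimes>\<^bsub>grp corr\<^esub> c)"
    by (simp add: corr_simps(2) H3.m_assoc del: H3_simps(2))
qed (auto simp: corr_simps)

lemma lattice_quotient_corr:
  assumes "0 < j" "0 < k"
  shows "lattice_quotient corr prod_d"
proof -
  interpret G: group "grp corr" by (rule group_corr)
  have inv: "inv\<^bsub>grp corr\<^esub> ((x, y, z), (x, y, z')) = ((-x, -y, -z), (-x, -y, -z'))" for x y z z'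
    by (rule G.inv_equality) (auto simp: corr_simps)
  have sub: "subgroup (lat corr) (grp corr)"
  proof (rule G.subgroupI)
    show "lat corr \<noteq> {}"
      using Lambda_iff[of k 0 0 0] Lambda_iff[of j 0 0 0] assms by (auto simp: corr_simps)
    fix a b assume a: "a \<in> lat corr" and b: "b \<in> lat corr"
    show "inv\<^bsub>grp corr\<^esub> a \<in> lat corr"
      using a subgroup.m_inv_closed[OF subgroup_Lambda[OF assms(1)]] subgroup.m_inv_closed[OF subgroup_Lambda[OF assms(2)]]
      by (force simp: corr_simps(4) inv)
    show "a \<otimes>\<^bsub>grp corr\<^esub> b \<in> lat corr"
      using a b subgroup.m_closed[OF subgroup_Lambda[OF assms(1)]] subgroup.m_closed[OF subgroup_Lambda[OF assms(2)]]
      by (force simp: corr_simps(2,4))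
  qed (auto simp: corr_simps)
  have dir: "dirD (\<lambda>y. g \<otimes>\<^bsub>grp corr\<^esub> y) x v = prod_d g v" for g x v
  proof (rule dirD_eq)
    have "(\<lambda>y. g \<otimes>\<^bsub>grp corr\<^esub> y) = (\<lambda>y. (fst g \<otimes>\<^bsub>H3\<^esub> fst y, snd g \<otimes>\<^bsub>H3\<^esub> snd y))"
      by (simp add: corr_simps(2) del: H3_simps(2))
    moreover have "((\<lambda>y. (fst g \<otimes>\<^bsub>H3\<^esub> fst y, snd g \<otimes>\<^bsub>H3\<^esub> snd y)) has_derivative prod_d g) (at x)"
      unfolding prod_d_def
      by (intro has_derivative_Pair has_derivative_compose[OF _ has_derivative_H3_mult] has_derivative_fst has_derivative_snd has_derivative_ident)
    ultimately show "((\<lambda>y. g \<otimes>\<^bsub>grp corr\<^esub> y) has_derivative prod_d g) (at x)" by simp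
  qed
  show ?thesis
  proof (rule lattice_quotient.intro[OF group_corr _ sub dir])
    show "subspace (space_of corr)"
      by (rule subspaceI) (auto simp: corr_simps(1) zero_prod_def)
    fix g h v
    show "prod_d (g \<otimes>\<^bsub>grp corr\<^esub> h) v = prod_d g (prod_d h v)"
      by (simp add: corr_simps(2) prod_d_def heis_d_mult del: H3_simps(2))
    show "prod_d g v \<in> space_of corr" if "g \<in> space_of corr" "v \<in> space_of corr"
      using that by (auto simp: corr_simps(1) prod_d_def)
    show "prod_d \<one>\<^bsub>grp corr\<^esub> v = v"
      by (cases v) (auto simp: corr_simps(3) prod_d_def)
  qed
qed

lemma left_invariant_poincare:
  assumes "0 < j" "0 < k"
  shows "left_invariant 2 (grp corr) (poincare c)"
proof -
  interpret P: lattice_quotient corr prod_d by (rule lattice_quotient_corr[OF assms])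
  have "poincare c (g \<otimes>\<^bsub>grp corr\<^esub> x) [prod_d g u, prod_d g v] = poincare c x [u, v]" for g x u v
    by (simp add: poincare_def corr_simps(2) prod_d_def contact_invariant del: H3_simps(2))
  then show ?thesis
    unfolding left_invariant_def
    by (auto simp: P.dirD_mult in_nlists_Suc_iff numeral_2_eq_2)
qed

end

lemma vertical_E_bundle:
  assumes "0 < k" "v \<in> space_of (E k)" "vertical (hmap (E_bundle k)) (dproj (E k) x v)"
  shows "\<exists>s. v = s *\<^sub>R (0, 0, 1)"
proof -
  interpret E: lattice_quotient "E k" heis_d by (rule lattice_quotient_E[OF assms(1)])
  have "bounded_linear (\<lambda>x::real \<times> real \<times> real. (fst x, fst (snd x)))"
    by (intro bounded_linear_Pair bounded_linear_fst bounded_linear_fst_comp bounded_linear_snd)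
  then have d: "dirD (hmap (E_bundle k)) y v = (fst v, fst (snd v))" for y v
    by (intro dirD_eq) (simp add: E_bundle_def case_prod_beta' bounded_linear_imp_has_derivative)
  \<comment> \<open>\<open>vertical\<close> speaks about every pair of the orbit; the pair given by
    the identity of the lattice is \<open>(x, v)\<close> itself.\<close>
  have "\<one>\<^bsub>grp (E k)\<^esub> \<in> lat (E k)"
    using E.subgroup_lat by (rule subgroup.one_closed)
  then have "(\<one>\<^bsub>grp (E k)\<^esub> \<otimes>\<^bsub>grp (E k)\<^esub> x, heis_d \<one>\<^bsub>grp (E k)\<^esub> v) \<in> dproj (E k) x v"
    by (subst E.dproj_eq) (auto simp: E_def)
  then have "dirD (hmap (E_bundle k)) x v = 0"
    using assms(3) E.A_one[OF assms(2)] unfolding vertical_def by (auto simp: d)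
  then show ?thesis by (cases v) (simp add: d zero_prod_def)
qed

text \<open>The fibres are one-dimensional: two vertical arguments are both multiples of
  \<open>(0, 0, 1)\<close>, so the determinant has two dependent arguments.\<close>

lemma admissible_E:
  assumes k: "0 < k" and H: "\<And>x u v w. H x [u, v, w] = c * det3 u v w"
  shows "admissible (E_bundle k) (induced H)"
  unfolding admissible_def
proof (intro ballI impI)
  interpret E: lattice_quotient "E k" heis_d by (rule lattice_quotient_E[OF k])
  have E: "total_space (E_bundle k) = E k" by (simp add: E_bundle_def)
  fix p ts
  assume p: "p \<in> points (total_space (E_bundle k))"
    and ts: "ts \<in> nlists 3 (tangent (total_space (E_bundle k)) p)"
    and ver: "\<exists>i<3. \<exists>j<3. i \<noteq> j \<and> vertical (hmap (E_bundle k)) (ts ! i) \<and> vertical (hmap (E_bundle k)) (ts ! j)"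
  obtain x where "\<And>k' ts. ts \<in> nlists k' (tangent (E k) p) \<Longrightarrow>
       \<exists>vs\<in>nlists k' (space_of (E k)). ts = map (dproj (E k) x) vs \<and> (\<forall>\<eta>. induced \<eta> p ts = \<eta> x vs)"
    using E.tangent_lift p unfolding E by metis
  then obtain vs where vs: "vs \<in> nlists 3 (space_of (E k))" "ts = map (dproj (E k) x) vs"
    "induced H p ts = H x vs"
    using ts unfolding E by blast
  then obtain u v w where uvw: "vs = [u, v, w]"
    by (auto simp: in_nlists_Suc_iff numeral_3_eq_3)
  have s: "\<exists>s. vs ! i = s *\<^sub>R (0, 0, 1)" if "i < 3" "vertical (hmap (E_bundle k)) (ts ! i)" for i
    using vertical_E_bundle[OF k, of "vs ! i" x] that nth_map[of i vs "dproj (E k) x"]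
    by (simp add: vs(2) uvw E_def)
  obtain i j where ij: "i < 3" "j < 3" "i \<noteq> j" "\<exists>s. vs ! i = s *\<^sub>R (0, 0, 1)" "\<exists>s. vs ! j = s *\<^sub>R (0, 0, 1)"
    using ver s by blast
  have "det3 u v w = 0"
  proof -
    from ij(1,2) have "i = 0 \<or> i = 1 \<or> i = 2" "j = 0 \<or> j = 1 \<or> j = 2" by auto
    with ij(3,4,5) show ?thesis
      by (cases u; cases v; cases w) (auto simp: uvw det3_def)
  qed
  then show "induced H p ts = 0" by (simp add: vs(3) uvw H)
qed

lemma invariantly_T_dual_E:
  assumes j: "0 < j" and k: "0 < k" and H: "diff_form 3 (carrier H3) H" "left_invariant 3 H3 H"
    "closed_form 3 (carrier H3) H" "nonzero_form 3 (carrier H3) H"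
  shows "invariantly_T_dual (E_bundle k) (induced H) (E_bundle j) (induced H)"
proof -
  let ?X = "fibre_product (E_bundle k) (E_bundle j)"
  interpret P: lattice_quotient ?X prod_d by (rule lattice_quotient_corr[OF j k])
  obtain c where c: "\<And>x u v w. H x [u, v, w] = c * det3 u v w"
    using invariant_three_form_eq[OF H(1,2)] by blast
  \<comment> \<open>\<open>c\<close> is also the coefficient of F on a pair of fibre directions, so
    a non-zero \<open>H\<close> is what makes F non-degenerate.\<close>
  have "c \<noteq> 0"
  proof
    assume "c = 0"
    obtain x vs where "vs \<in> nlists 3 (carrier H3)" "H x vs \<noteq> 0"
      using H(4) unfolding nonzero_form_def by blast
    then show False by (auto simp: in_nlists_Suc_iff numeral_3_eq_3 c \<open>c = 0\<close>)
  qed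
  have E: "total_space (E_bundle i) = E i" "base_space (E_bundle i) = T2" for i
    by (simp_all add: E_bundle_def)
  have EH: "invariant_form 3 (E i) (induced H)" "nil_closed 3 (E i) (induced H)" if "0 < i" for i
  proof -
    interpret E: lattice_quotient "E i" heis_d by (rule lattice_quotient_E[OF that])
    have "grp (E i) = H3" by (simp add: E_def)
    with H show "invariant_form 3 (E i) (induced H)" "nil_closed 3 (E i) (induced H)"
      using E.invariant_form_induced[of 3 H] E.nil_closed_induced[of 3 H] by simp_all
  qed
  define F where "F = induced (poincare c)"
  have inv: "left_invariant 2 (grp ?X) (poincare c)"
    by (rule left_invariant_poincare[OF j k])
  have F: "invariant_form 2 ?X F"
    unfolding F_def by (rule P.invariant_form_induced[OF inv diff_form_poincare])
  have d_fst: "dirD fst x v = fst v" and d_snd: "dirD snd x v = snd v"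
    for x v :: "(real \<times> real \<times> real) \<times> (real \<times> real \<times> real)"
    by (auto intro!: dirD_eq bounded_linear_imp_has_derivative bounded_linear_fst bounded_linear_snd)
  have one: "\<one>\<^bsub>grp ?X\<^esub> \<in> lat ?X"
    using P.subgroup_lat by (rule subgroup.one_closed)
  have vert: "vertical snd (dproj ?X x v) \<longleftrightarrow> snd v = 0" "vertical fst (dproj ?X x v) \<longleftrightarrow> fst v = 0"
    "zero_tvec (dproj ?X x v) \<longleftrightarrow> v = 0"
    if "x \<in> space_of ?X" "v \<in> space_of ?X" for x v
  proof -
    \<comment> \<open>Injectivity of \<open>heis_d g\<close> makes vanishing of a component
      independent of the point of the orbit, so it can be tested at \<open>x\<close>.\<close>
    have z: "heis_d g u = 0 \<longleftrightarrow> u = 0" for g u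
      by (cases g; cases u) (auto simp: zero_prod_def)
    have zz: "(heis_d g u, heis_d h w) = 0 \<longleftrightarrow> (u, w) = 0" for g u h w
      by (simp add: z Pair_eq_zero_iff)
    show "vertical snd (dproj ?X x v) \<longleftrightarrow> snd v = 0" "vertical fst (dproj ?X x v) \<longleftrightarrow> fst v = 0"
      "zero_tvec (dproj ?X x v) \<longleftrightarrow> v = 0"
      using one unfolding vertical_def zero_tvec_def P.dproj_eq[OF that]
      by (auto simp: d_snd d_fst prod_d_def z zz simp del: split_paired_Ex split_paired_All)
  qed
  have nd: "nondegenerate_on_fibres (E_bundle k) (E_bundle j) F"
    unfolding nondegenerate_on_fibres_def Let_def
  proof (rule ballI)
    fix p assume p: "p \<in> points ?X"
    obtain x where x: "x \<in> space_of ?X" "p = proj ?X x"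
      and lift: "\<And>k ts. ts \<in> nlists k (tangent ?X p) \<Longrightarrow> \<exists>vs\<in>nlists k (space_of ?X). ts = map (dproj ?X x) vs"
      using P.tangent_lift[OF p] by metis
    have lift1: "\<exists>v\<in>space_of ?X. t = dproj ?X x v" if "t \<in> tangent ?X p" for t
      using lift[of "[t]" 1] that by (auto simp: in_nlists_Suc_iff)
    have in_tangent: "dproj ?X x v \<in> tangent ?X p" if "v \<in> space_of ?X" for v
      using that x P.mem_proj_self unfolding tangent_def by blast
    have F_eq: "F p [dproj ?X x v, dproj ?X x w] = poincare c x [v, w]"
      if "v \<in> space_of ?X" "w \<in> space_of ?X" for v w
      using P.pull_induced[OF inv x(1), of "[v, w]"] that x(2)
      by (simp add: pull_def F_def in_nlists_Suc_iff numeral_2_eq_2)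
    have v1: "((0, 0, s), 0) \<in> space_of ?X" and v2: "(0, (0, 0, s)) \<in> space_of ?X" for s :: real
      by (simp_all add: corr_simps(1) zero_prod_def)
    have pc: "poincare c x [((0, 0, s), 0), (0, (0, 0, s'))] = c * s * s'" for s s'
      by (simp add: poincare_def contact_def)
    have "\<exists>t'\<in>{t \<in> tangent ?X p. vertical fst t}. F p [t, t'] \<noteq> 0"
      if t: "t \<in> tangent ?X p" "vertical snd t" "\<not> zero_tvec t" for t
    proof -
      obtain v where v: "v \<in> space_of ?X" "t = dproj ?X x v" using lift1[OF t(1)] by blast
      then have "snd v = 0" "v \<noteq> 0" using t vert[OF x(1)] by auto
      \<comment> \<open>The two components of \<open>v\<close> agree in the first two coordinates;
        as the second component is 0, only a central part of the first remains. The unit central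
        vector of the other factor then detects it.\<close>
      with v(1) obtain s where s: "v = ((0, 0, s), 0)" "s \<noteq> 0"
        by (auto simp: corr_simps(1) Pair_eq_zero_iff)
      show ?thesis
      proof (rule bexI[of _ "dproj ?X x (0, (0, 0, 1))"])
        show "F p [t, dproj ?X x (0, (0, 0, 1))] \<noteq> 0"
          using F_eq[OF v(1) v2] s \<open>c \<noteq> 0\<close> by (simp add: v(2) pc)
      qed (use in_tangent v2 vert[OF x(1)] in simp)
    qed
    moreover have "\<exists>t\<in>{t \<in> tangent ?X p. vertical snd t}. F p [t, t'] \<noteq> 0"
      if t: "t' \<in> tangent ?X p" "vertical fst t'" "\<not> zero_tvec t'" for t'
    proof -
      obtain v where v: "v \<in> space_of ?X" "t' = dproj ?X x v" using lift1[OF t(1)] by blast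
      then have "fst v = 0" "v \<noteq> 0" using t vert[OF x(1)] by auto
      with v(1) obtain s where s: "v = (0, (0, 0, s))" "s \<noteq> 0"
        by (auto simp: corr_simps(1) Pair_eq_zero_iff)
      show ?thesis
      proof (rule bexI[of _ "dproj ?X x ((0, 0, 1), 0)"])
        show "F p [dproj ?X x ((0, 0, 1), 0), t'] \<noteq> 0"
          using F_eq[OF v1 v(1)] s \<open>c \<noteq> 0\<close> by (simp add: v(2) pc)
      qed (use in_tangent v1 vert[OF x(1)] in simp)
    qed
    ultimately show "(\<forall>t\<in>{t \<in> tangent ?X p. vertical snd t}. \<not> zero_tvec t \<longrightarrow>
          (\<exists>t'\<in>{t \<in> tangent ?X p. vertical fst t}. F p [t, t'] \<noteq> 0)) \<and>
        (\<forall>t'\<in>{t \<in> tangent ?X p. vertical fst t}. \<not> zero_tvec t' \<longrightarrow>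
          (\<exists>t\<in>{t \<in> tangent ?X p. vertical snd t}. F p [t, t'] \<noteq> 0))"
      by simp
  qed
  \<comment> \<open>Integral \<open>(x, y, 0)\<close> lies in every \<open>Lambda\<close>, so both
    projections of the fibre product lattice are onto. Hence the image of a coset or of an orbit is
    a full one downstairs.\<close>
  have lat_E: "((x, y, z), (x, y, 0)) \<in> lat ?X" if "(x, y, z) \<in> lat (E k)" for x y z
    using that by (simp add: corr_simps(4) E_def Lambda_iff[OF k] Lambda_iff[OF j])
  have lat_E': "((x, y, 0), (x, y, z)) \<in> lat ?X" if "(x, y, z) \<in> lat (E j)" for x y z
    using that by (simp add: corr_simps(4) E_def Lambda_iff[OF k] Lambda_iff[OF j])
  have lat_fst: "fst ` lat ?X = lat (E k)"
  proof
    show "lat (E k) \<subseteq> fst ` lat ?X"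
      using lat_E by (auto intro!: image_eqI[where f = fst])
  qed (auto simp: corr_simps(4) E_def)
  have lat_snd: "snd ` lat ?X = lat (E j)"
  proof
    show "lat (E j) \<subseteq> snd ` lat ?X"
      using lat_E' by (auto intro!: image_eqI[where f = snd])
  qed (auto simp: corr_simps(4) E_def)
  \<comment> \<open>\<open>q\<close> stands for either projection, a linear homomorphism commuting
    with the differentials of translations.\<close>
  have pull: "pullback q (induced H) (proj ?X x) (map (dproj ?X x) vs) = H (q x) (map q vs)"
    if q: "q ` lat ?X = lat (E i)" "\<And>g h. q (g \<otimes>\<^bsub>grp ?X\<^esub> h) = q g \<otimes>\<^bsub>H3\<^esub> q h"
      "\<And>g v. q (prod_d g v) = heis_d (q g) (q v)" "\<And>x v. dirD q x v = q v"
      and i: "0 < i" and x: "x \<in> space_of ?X" and vs: "vs \<in> nlists 3 (space_of ?X)" for q i x vs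
  proof -
    interpret E: lattice_quotient "E i" heis_d by (rule lattice_quotient_E[OF i])
    have Ei: "grp (E i) = H3" by (simp add: E_def)
    have "q ` proj ?X x = proj (E i) (q x)"
      unfolding P.proj_eq E.proj_eq by (simp add: image_image q(2) Ei flip: q(1))
    moreover have "tmap q (dproj ?X x v) = dproj (E i) (q x) (q v)" if "v \<in> space_of ?X" for v
      using that x by (simp add: tmap_def P.dproj_eq E.dproj_eq image_image q(2,3,4) Ei flip: q(1))
    moreover have "map q vs \<in> nlists 3 (space_of (E i))"
      using vs by (intro nlistsI) (auto simp: Ei)
    ultimately show ?thesis
      using E.pull_induced[of 3 H "q x" "map q vs"] H(2) nlists_mem[OF vs]
      by (simp add: pullback_def pull_def Ei o_def cong: map_cong)
  qed
  have ext: "pullback fst (induced H) p ts - pullback snd (induced H) p ts = nil_extd ?X F p ts"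
    if p: "p \<in> points ?X" and ts: "ts \<in> nlists 3 (tangent ?X p)" for p ts
  proof -
    obtain x vs where x: "x \<in> space_of ?X" "p = proj ?X x" and vs: "vs \<in> nlists 3 (space_of ?X)"
      "ts = map (dproj ?X x) vs" "nil_extd ?X F p ts = extd (poincare c) x vs"
      using P.nil_extd_induced[OF inv p] ts unfolding F_def by (metis numeral_3_eq_3 numeral_2_eq_2)
    obtain v0 v1 v2 where v: "vs = [v0, v1, v2]" "{v0, v1, v2} \<subseteq> space_of ?X"
      using vs(1) by (auto simp: in_nlists_Suc_iff numeral_3_eq_3)
    have "extd (poincare c) x vs =
        c * det3 (fst v0) (fst v1) (fst v2) - c * det3 (snd v0) (snd v1) (snd v2)"
      unfolding v(1) using x(1) v(2) by (intro extd_poincare) (auto simp: corr_simps(1))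
    moreover have "pullback fst (induced H) p ts = H (fst x) (map fst vs)"
      "pullback snd (induced H) p ts = H (snd x) (map snd vs)"
      unfolding x(2) vs(2)
      by (rule pull[OF lat_fst _ _ d_fst k x(1) vs(1)] pull[OF lat_snd _ _ d_snd j x(1) vs(1)];
          simp add: corr_simps(2) prod_d_def del: H3_simps(2))+
    ultimately show ?thesis using vs(3) by (simp add: v(1) c)
  qed
  show ?thesis
    unfolding invariantly_T_dual_def E
    using principal_torus_bundle_E[OF j] principal_torus_bundle_E[OF k] EH[OF j] EH[OF k]
      admissible_E[OF j c] admissible_E[OF k c] F nd ext
    by (auto simp: E_def)
qed

section \<open>Fundamental groups\<close>

lemma continuous_on_H3_mult [continuous_intros]:
  assumes "continuous_on S f" "continuous_on S g"
  shows "continuous_on S (\<lambda>x. f x \<otimes>\<^bsub>H3\<^esub> g x)"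
proof -
  have "f x \<otimes>\<^bsub>H3\<^esub> g x = (fst (f x) + fst (g x), fst (snd (f x)) + fst (snd (g x)),
      snd (snd (f x)) + snd (snd (g x)) + (fst (f x) * fst (snd (g x)) - fst (snd (f x)) * fst (g x)) / 2)" for x
    by (cases "f x"; cases "g x") simp
  then show ?thesis by (auto intro!: continuous_intros assms)
qed

lemma H3_inv_eq: "inv\<^bsub>H3\<^esub> x = - x"
  by (cases x) simp

lemma continuous_on_H3_inv [continuous_intros]:
  "continuous_on S f \<Longrightarrow> continuous_on S (\<lambda>x. inv\<^bsub>H3\<^esub> f x)"
  unfolding H3_inv_eq by (rule continuous_on_minus)

lemma proj_E_eq_iff:
  assumes "0 < k"
  shows "proj (E k) x = proj (E k) y \<longleftrightarrow> x \<otimes>\<^bsub>H3\<^esub> inv\<^bsub>H3\<^esub> y \<in> Lambda k"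
proof -
  interpret E: lattice_quotient "E k" heis_d by (rule lattice_quotient_E[OF assms])
  have E: "grp (E k) = H3" "lat (E k) = Lambda k" by (simp_all add: E_def)
  show ?thesis
  proof
    assume "proj (E k) x = proj (E k) y"
    then obtain l where "l \<in> Lambda k" "x = l \<otimes>\<^bsub>H3\<^esub> y"
      by (rule E.proj_eqD[of x y, rotated 2]) (simp_all add: E)
    then show "x \<otimes>\<^bsub>H3\<^esub> inv\<^bsub>H3\<^esub> y \<in> Lambda k"
      by (simp add: H3.m_assoc del: H3_simps(2,3))
  next
    assume "x \<otimes>\<^bsub>H3\<^esub> inv\<^bsub>H3\<^esub> y \<in> Lambda k"
    then show "proj (E k) x = proj (E k) y"
      using E.proj_mult[of "x \<otimes>\<^bsub>H3\<^esub> inv\<^bsub>H3\<^esub> y" y] by (simp add: E H3.m_assoc del: H3_simps(2,3))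
  qed
qed

text \<open>This is the uniqueness half of lifting: two lifts of one map differ by a continuous
  function with values in the discrete lattice.\<close>

lemma continuous_into_Lambda_constant:
  fixes g :: "'a::topological_space \<Rightarrow> real \<times> real \<times> real"
  assumes k: "0 < k" and S: "connected S" and g: "continuous_on S g" "g ` S \<subseteq> Lambda k"
    and x: "x \<in> S" "y \<in> S"
  shows "g x = g y"
proof -
  obtain e where e: "e > 0" "\<And>a b. a \<in> Lambda k \<Longrightarrow> b \<in> Lambda k \<Longrightarrow> dist a b < e \<Longrightarrow> a = b"
    using uniform_discrete_Lambda[OF k] unfolding uniform_discrete_def by blast
  have "g ` S \<subseteq> {y. connected_component_set (g ` S) y = {y}}"
    using g(1)
  proof (rule discrete_subset_disconnected)
    fix x assume "x \<in> S"
    then have "\<not> dist (g y) (g x) < e" if "y \<in> S" "g y \<noteq> g x" for y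
      using e(2)[of "g y" "g x"] g(2) that by blast
    then show "\<exists>e>0. \<forall>y. y \<in> S \<and> g y \<noteq> g x \<longrightarrow> e \<le> norm (g y - g x)"
      using e(1) by (intro exI[of _ e]) (simp add: dist_norm not_less)
  qed
  then have "connected_component_set (g ` S) (g x) = {g x}" using x by blast
  moreover have "connected_component_set (g ` S) (g x) = g ` S"
    using connected_continuous_image[OF g(1) S] x connected_iff_eq_connected_component_set by blast
  ultimately show ?thesis using x by (metis imageI singletonD)
qed

text \<open>The fibre product of \<open>f \<circ> proj (E j)\<close> with \<open>proj (E i)\<close> covers the simply connected
  space \<open>H3\<close>, so it has a section.\<close>

lemma covering_space_lift_set:
  assumes j: "0 < j" and i: "0 < i" and f: "smooth_map (E j) (E i) f"
  shows "covering_space {(x, y). proj (E i) y = f (proj (E j) x)} fst UNIV" (is "covering_space ?S fst UNIV")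
proof
  interpret Ej: lattice_quotient "E j" heis_d by (rule lattice_quotient_E[OF j])
  interpret Ei: lattice_quotient "E i" heis_d by (rule lattice_quotient_E[OF i])
  have E [simp]: "grp (E k) = H3" "lat (E k) = Lambda k" for k by (simp_all add: E_def)
  have pts: "f (proj (E j) x) \<in> points (E i)" for x
    using f Ej.proj_in_points[of x] unfolding smooth_map_def by auto
  show "continuous_on ?S fst" by (intro continuous_intros)
  have "x \<in> fst ` ?S" for x
  proof -
    obtain y where "f (proj (E j) x) = proj (E i) y"
      using pts[of x] by (auto simp: points_def RCOSETS_def proj_def)
    then show ?thesis by (intro image_eqI[of _ _ "(x, y)"]) auto
  qed
  then show "fst ` ?S = UNIV" by blast
  fix x :: "real \<times> real \<times> real"
  have "proj (E j) x \<in> points (E j)" using Ej.proj_in_points[of x] by simp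
  then obtain U W where U: "chart_dom (E j) U" and W: "chart_dom (E i) W" and xU: "proj (E j) x \<in> proj (E j) ` U"
    and sub: "f ` proj (E j) ` U \<subseteq> proj (E i) ` W"
    and sm: "smooth_in (space_of (E j)) U (the_inv_into W (proj (E i)) \<circ> f \<circ> proj (E j))"
    using f unfolding smooth_map_def by meson
  define h where "h = the_inv_into W (proj (E i)) \<circ> f \<circ> proj (E j)"
  have "Ck 0 (space_of (E j)) U h" using sm unfolding smooth_in_def h_def by blast
  then have h: "continuous_on U h" by simp
  have "open U" using U by (simp add: chart_dom_def)
  have ph: "proj (E i) (h u) = f (proj (E j) u)" if "u \<in> U" for u
    using W sub that unfolding chart_dom_def h_def o_def
    by (intro f_the_inv_into_f) auto
  \<comment> \<open>The chart domain contains a lattice translate \<open>u0\<close> of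
    \<open>x\<close>, not necessarily \<open>x\<close>; the translation \<open>t\<close> below
    brings a neighbourhood of \<open>x\<close> into \<open>U\<close>.\<close>
  obtain u0 where u0: "u0 \<in> U" "proj (E j) x = proj (E j) u0" using xU by blast
  obtain l where l: "l \<in> Lambda j" "x = l \<otimes>\<^bsub>H3\<^esub> u0"
    by (rule Ej.proj_eqD[of x u0, rotated 2]) (use u0 in simp_all)
  have il: "inv\<^bsub>H3\<^esub> l \<in> Lambda j" using subgroup.m_inv_closed[OF subgroup_Lambda[OF j] l(1)] .
  define t where "t y = inv\<^bsub>H3\<^esub> l \<otimes>\<^bsub>H3\<^esub> y" for y
  have t: "continuous_on A t" for A unfolding t_def by (intro continuous_intros)
  define T where "T = t -` U"
  have "open T" unfolding T_def using \<open>open U\<close> t by (rule open_vimage)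
  have "t x = u0" unfolding t_def l(2) by (simp add: H3.m_assoc[symmetric] del: H3_simps(2,3) H3_inv)
  then have "x \<in> T" using u0 by (simp add: T_def)
  define s where "s y = h (t y)" for y
  have s: "continuous_on T s"
    unfolding s_def by (rule continuous_on_compose2[OF h t]) (auto simp: T_def)
  have ps: "proj (E i) (s y) = f (proj (E j) y)" if "y \<in> T" for y
    using that ph[of "t y"] Ej.proj_mult[of "inv\<^bsub>H3\<^esub> l" y] il by (simp add: s_def T_def t_def)
  \<comment> \<open>The sheets over \<open>T\<close>: graphs of the local lift \<open>s\<close>
    translated by the elements of the target lattice.\<close>
  define V where "V m = (\<lambda>y. (y, m \<otimes>\<^bsub>H3\<^esub> s y)) ` T" for m
  have pm: "proj (E i) (m \<otimes>\<^bsub>H3\<^esub> s y) = f (proj (E j) y)" if "m \<in> Lambda i" "y \<in> T" for m y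
    using Ei.proj_mult[of m "s y"] that ps by simp
  \<comment> \<open>Each sheet is a level set of one continuous lattice-valued function on the part
    over \<open>T\<close>; openness, disjointness and exhaustion are all read off from this.\<close>
  have V_eq: "V m = {q \<in> ?S. fst q \<in> T \<and> snd q \<otimes>\<^bsub>H3\<^esub> inv\<^bsub>H3\<^esub> s (fst q) = m}" if m: "m \<in> Lambda i" for m
  proof (intro subset_antisym subsetI)
    fix q assume "q \<in> V m"
    then obtain y where y: "y \<in> T" "q = (y, m \<otimes>\<^bsub>H3\<^esub> s y)" by (auto simp: V_def)
    then show "q \<in> {q \<in> ?S. fst q \<in> T \<and> snd q \<otimes>\<^bsub>H3\<^esub> inv\<^bsub>H3\<^esub> s (fst q) = m}"
      using pm[OF m] by (simp add: H3.m_assoc del: H3_simps(2,3) H3_inv)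
  next
    fix q assume q: "q \<in> {q \<in> ?S. fst q \<in> T \<and> snd q \<otimes>\<^bsub>H3\<^esub> inv\<^bsub>H3\<^esub> s (fst q) = m}"
    then have "m \<otimes>\<^bsub>H3\<^esub> s (fst q) = snd q"
      by (auto simp: H3.m_assoc simp del: H3_simps(2,3) H3_inv)
    with q show "q \<in> V m"
      unfolding V_def by (intro image_eqI[of _ _ "fst q"]) (auto simp: prod_eq_iff)
  qed
  have opT: "openin (top_of_set ?S) (?S \<inter> fst -` T)"
    by (rule continuous_openin_preimage_gen[OF _ \<open>open T\<close>]) (intro continuous_intros)
  have kappa: "snd q \<otimes>\<^bsub>H3\<^esub> inv\<^bsub>H3\<^esub> s (fst q) \<in> Lambda i" if "q \<in> ?S \<inter> fst -` T" for q
    using that ps[of "fst q"] proj_E_eq_iff[OF i, of "snd q" "s (fst q)"] by auto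
  have "openin (top_of_set ?S) (V m)" if m: "m \<in> Lambda i" for m
  proof -
    obtain Q where Q: "open Q" "Q \<inter> Lambda i = {m}"
      using uniform_discrete_imp_discrete[OF uniform_discrete_Lambda[OF i]] m
      unfolding discrete_def isolated_in_def by blast
    have "continuous_on (?S \<inter> fst -` T) (\<lambda>q. snd q \<otimes>\<^bsub>H3\<^esub> inv\<^bsub>H3\<^esub> s (fst q))"
      by (intro continuous_intros continuous_on_compose2[OF s]) auto
    then have "openin (top_of_set (?S \<inter> fst -` T))
        ((?S \<inter> fst -` T) \<inter> (\<lambda>q. snd q \<otimes>\<^bsub>H3\<^esub> inv\<^bsub>H3\<^esub> s (fst q)) -` Q)"
      using Q(1) by (rule continuous_openin_preimage_gen)
    moreover have "(?S \<inter> fst -` T) \<inter> (\<lambda>q. snd q \<otimes>\<^bsub>H3\<^esub> inv\<^bsub>H3\<^esub> s (fst q)) -` Q = V m"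
      unfolding V_eq[OF m] using kappa Q(2) by blast
    ultimately have "openin (top_of_set (?S \<inter> fst -` T)) (V m)" by simp
    then show ?thesis using opT by (rule openin_trans)
  qed
  moreover have "\<Union>(V ` Lambda i) = ?S \<inter> fst -` T"
    using kappa by (auto simp: V_eq)
  moreover have "pairwise disjnt (V ` Lambda i)"
    by (auto simp: pairwise_def disjnt_def V_eq)
  moreover have "\<exists>q. homeomorphism (V m) T fst q" for m
  proof
    show "homeomorphism (V m) T fst (\<lambda>y. (y, m \<otimes>\<^bsub>H3\<^esub> s y))"
      unfolding homeomorphism_def V_def by (auto intro!: continuous_intros s simp: image_image)
  qed
  ultimately show "\<exists>T. x \<in> T \<and> openin (top_of_set UNIV) T \<and>
      (\<exists>v. \<Union>v = ?S \<inter> fst -` T \<and> (\<forall>u\<in>v. openin (top_of_set ?S) u) \<and> pairwise disjnt v \<and>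
        (\<forall>u\<in>v. \<exists>q. homeomorphism u T fst q))"
    using \<open>x \<in> T\<close> \<open>open T\<close> by (intro exI[of _ T] conjI exI[of _ "V ` Lambda i"]) auto
qed

text \<open>The section is the lift of the identity of \<open>H3\<close> through the covering
  \<open>fst\<close>; its second component is \<open>F\<close>.\<close>

lemma smooth_map_lift:
  assumes "0 < j" "0 < i" "smooth_map (E j) (E i) f"
  obtains F where "continuous_on UNIV F" "\<And>x. proj (E i) (F x) = f (proj (E j) x)"
proof -
  have lpc: "locally path_connected (UNIV :: (real \<times> real \<times> real) set)"
    by (simp add: convex_imp_locally_path_connected)
  have sc: "simply_connected (UNIV :: (real \<times> real \<times> real) set)"
    by (simp add: convex_imp_simply_connected)
  show thesis
  proof (rule covering_space_lift[OF covering_space_lift_set[OF assms] sc lpc continuous_on_id])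
    show "(\<lambda>x. x) \<in> UNIV \<rightarrow> UNIV" by simp
    fix g assume g: "continuous_on UNIV g" "g \<in> UNIV \<rightarrow> {(x, y). proj (E i) y = f (proj (E j) x)}"
      and fst: "\<And>x. x \<in> UNIV \<Longrightarrow> fst (g x) = x"
    show thesis
    proof (rule that)
      show "continuous_on UNIV (\<lambda>x. snd (g x))" by (intro continuous_intros g(1))
      fix x
      have "g x \<in> {(x, y). proj (E i) y = f (proj (E j) x)}"
        using g(2) UNIV_I by (rule funcset_mem)
      then show "proj (E i) (snd (g x)) = f (proj (E j) x)"
        using fst[of x] by (simp add: case_prod_beta')
    qed
  qed
qed

text \<open>\<open>F (l x)\<close> and \<open>F x\<close> lie over the same point, so they differ by
  a lattice element, which depends continuously on \<open>x\<close> and is therefore constant. The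
  map \<open>\<phi>\<close> is the one induced on deck groups.\<close>

lemma lift_equivariant:
  assumes j: "0 < j" and i: "0 < i" and F: "continuous_on UNIV F" "\<And>x. proj (E i) (F x) = f (proj (E j) x)"
  obtains \<phi> where "\<And>l. l \<in> Lambda j \<Longrightarrow> \<phi> l \<in> Lambda i"
    "\<And>l x. l \<in> Lambda j \<Longrightarrow> F (l \<otimes>\<^bsub>H3\<^esub> x) = \<phi> l \<otimes>\<^bsub>H3\<^esub> F x"
proof
  interpret Ej: lattice_quotient "E j" heis_d by (rule lattice_quotient_E[OF j])
  have E [simp]: "grp (E k) = H3" "lat (E k) = Lambda k" for k by (simp_all add: E_def)
  define \<phi> where "\<phi> l = F (l \<otimes>\<^bsub>H3\<^esub> 0) \<otimes>\<^bsub>H3\<^esub> inv\<^bsub>H3\<^esub> F 0" for l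
  have in_Lambda: "F (l \<otimes>\<^bsub>H3\<^esub> x) \<otimes>\<^bsub>H3\<^esub> inv\<^bsub>H3\<^esub> F x \<in> Lambda i" if "l \<in> Lambda j" for l x
    using that Ej.proj_mult[of l x] by (subst proj_E_eq_iff[OF i, symmetric]) (simp add: F(2))
  then show "\<phi> l \<in> Lambda i" if "l \<in> Lambda j" for l using that by (simp add: \<phi>_def)
  show "F (l \<otimes>\<^bsub>H3\<^esub> x) = \<phi> l \<otimes>\<^bsub>H3\<^esub> F x" if l: "l \<in> Lambda j" for l x
  proof -
    have "F (l \<otimes>\<^bsub>H3\<^esub> x) \<otimes>\<^bsub>H3\<^esub> inv\<^bsub>H3\<^esub> F x = \<phi> l"
      unfolding \<phi>_def
    proof (rule continuous_into_Lambda_constant[OF i, of UNIV "\<lambda>x. F (l \<otimes>\<^bsub>H3\<^esub> x) \<otimes>\<^bsub>H3\<^esub> inv\<^bsub>H3\<^esub> F x"])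
      show "continuous_on UNIV (\<lambda>x. F (l \<otimes>\<^bsub>H3\<^esub> x) \<otimes>\<^bsub>H3\<^esub> inv\<^bsub>H3\<^esub> F x)"
        by (intro continuous_intros continuous_on_compose2[OF F(1)] F(1)) auto
    qed (use in_Lambda[OF l] in auto)
    from this[symmetric] show ?thesis by (simp add: H3.m_assoc del: H3_simps(2,3) H3_inv)
  qed
qed

text \<open>The deck transformations of \<open>H3\<close> over \<open>E j\<close> are the left
  multiplications by lattice elements. The element \<open>c\<close> may be non-trivial, since
  \<open>F\<close> fixes no base point.\<close>

lemma lift_of_identity:
  assumes j: "0 < j" and F: "continuous_on UNIV F" "\<And>x. proj (E j) (F x) = proj (E j) x"
  obtains c where "c \<in> Lambda j" "\<And>x. F x = c \<otimes>\<^bsub>H3\<^esub> x"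
proof
  have in_Lambda: "F x \<otimes>\<^bsub>H3\<^esub> inv\<^bsub>H3\<^esub> x \<in> Lambda j" for x
    using F(2) by (simp add: proj_E_eq_iff[OF j] del: H3_simps(2,3) H3_inv)
  show "F 0 \<otimes>\<^bsub>H3\<^esub> inv\<^bsub>H3\<^esub> 0 \<in> Lambda j" by (rule in_Lambda)
  show "F x = F 0 \<otimes>\<^bsub>H3\<^esub> inv\<^bsub>H3\<^esub> 0 \<otimes>\<^bsub>H3\<^esub> x" for x
  proof -
    have "F x \<otimes>\<^bsub>H3\<^esub> inv\<^bsub>H3\<^esub> x = F 0 \<otimes>\<^bsub>H3\<^esub> inv\<^bsub>H3\<^esub> 0"
    proof (rule continuous_into_Lambda_constant[OF j, of UNIV "\<lambda>x. F x \<otimes>\<^bsub>H3\<^esub> inv\<^bsub>H3\<^esub> x"])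
      show "continuous_on UNIV (\<lambda>x. F x \<otimes>\<^bsub>H3\<^esub> inv\<^bsub>H3\<^esub> x)"
        by (intro continuous_intros F(1))
    qed (use in_Lambda in auto)
    from this[symmetric] show ?thesis by (simp add: H3.m_assoc del: H3_simps(2,3) H3_inv)
  qed
qed

section \<open>Homomorphisms between the lattices and their action on the centres\<close>

lemma additive_int_eq:
  fixes A :: "int \<Rightarrow> real"
  assumes add: "\<And>m n. A (m + n) = A m + A n"
  shows "A n = n * A 1"
proof (induction n rule: int_induct[where k = 0])
  case base
  show ?case using add[of 0 0] by simp
next
  case (step1 n)
  then show ?case using add[of n 1] by (simp add: algebra_simps)
next
  case (step2 n)
  then show ?case using add[of "n - 1" 1] by (simp add: algebra_simps)
qed

text \<open>Commuting with \<open>(0, 1, 0)\<close> forces the first coordinate to vanish, and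
  commuting with \<open>(1, 0, 0)\<close> the second.\<close>

lemma Lambda_central:
  assumes i: "0 < i" and g: "\<And>m. m \<in> Lambda i \<Longrightarrow> m \<otimes>\<^bsub>H3\<^esub> g = g \<otimes>\<^bsub>H3\<^esub> m"
  shows "fst g = 0" "fst (snd g) = 0"
proof -
  obtain x y z where "g = (x, y, z)" by (cases g)
  moreover have "(1, 0, 0) \<in> Lambda i" "(0, 1, 0) \<in> Lambda i" by (simp_all add: Lambda_iff[OF i])
  from this[THEN g] show "fst g = 0" "fst (snd g) = 0" by (simp_all add: calculation)
qed

text \<open>Surjectivity makes the image of the centre commute with all of \<open>Lambda i\<close>.
  On the infinite cyclic centres, measured in units of their generators, the map is then
  multiplication by an integer.\<close>

lemma central_hom_linear:
  assumes j: "0 < j" and i: "0 < i"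
    and \<phi>: "\<And>l. l \<in> Lambda j \<Longrightarrow> \<phi> l \<in> Lambda i"
    and hom: "\<And>l m. l \<in> Lambda j \<Longrightarrow> m \<in> Lambda j \<Longrightarrow> \<phi> (l \<otimes>\<^bsub>H3\<^esub> m) = \<phi> l \<otimes>\<^bsub>H3\<^esub> \<phi> m"
    and surj: "\<And>m. m \<in> Lambda i \<Longrightarrow> \<exists>l\<in>Lambda j. \<phi> l = m"
  obtains a :: int where "\<And>n::int. \<phi> (0, 0, n / (2 * real j)) = (0, 0, real_of_int n * real_of_int a / (2 * real i))"
proof -
  have z: "(0, 0, real_of_int n / (2 * real j)) \<in> Lambda j" for n
    using j by (simp add: Lambda_iff[OF j])
  define A where "A n = 2 * real i * snd (snd (\<phi> (0, 0, real_of_int n / (2 * real j))))" for n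
  have central: "fst (\<phi> (0, 0, n / (2 * real j))) = 0" "fst (snd (\<phi> (0, 0, n / (2 * real j)))) = 0" for n :: int
  proof -
    have "m \<otimes>\<^bsub>H3\<^esub> \<phi> (0, 0, n / (2 * real j)) = \<phi> (0, 0, n / (2 * real j)) \<otimes>\<^bsub>H3\<^esub> m" if m: "m \<in> Lambda i" for m
    proof -
      obtain l where l: "l \<in> Lambda j" "\<phi> l = m" using surj[OF m] by blast
      have "l \<otimes>\<^bsub>H3\<^esub> (0, 0, n / (2 * real j)) = (0, 0, n / (2 * real j)) \<otimes>\<^bsub>H3\<^esub> l" by (cases l) simp
      then show ?thesis using hom[OF l(1) z] hom[OF z l(1)] l(2) by metis
    qed
    from Lambda_central[OF i this]
    show "fst (\<phi> (0, 0, n / (2 * real j))) = 0" "fst (snd (\<phi> (0, 0, n / (2 * real j)))) = 0" by auto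
  qed
  have phi: "\<phi> (0, 0, n / (2 * real j)) = (0, 0, A n / (2 * real i))" for n :: int
    using central[of n] i by (simp add: A_def prod_eq_iff)
  have "A (m + n) = A m + A n" for m n
    using hom[OF z[of m] z[of n]] i by (simp add: phi add_divide_distrib[symmetric] flip: of_int_add)
  then have A: "A n = n * A 1" for n by (rule additive_int_eq)
  have "A 1 \<in> \<int>" using \<phi>[OF z[of 1]] i unfolding phi by (simp add: Lambda_iff[OF i])
  then obtain a :: int where a: "A 1 = a" by (auto elim: Ints_cases)
  show thesis 
  proof (rule that[of a])
    show "\<phi> (0, 0, n / (2 * real j)) = (0, 0, real_of_int n * real_of_int a / (2 * real i))" for n :: int
      using phi[of n] A[of n] a by simp
  qed
qed

lemma swap_difference: "(a - b) / 2 = t + (b - a) / 2 \<Longrightarrow> t = a - b" for a b t :: real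
  by (simp add: field_simps)

lemma diffeomorphic_imp_dvd:
  assumes j: "0 < j" and i: "0 < i" and f: "smooth_map (E j) (E i) f" and g: "smooth_map (E i) (E j) g"
    and gf: "\<And>p. p \<in> points (E j) \<Longrightarrow> g (f p) = p" and fg: "\<And>p. p \<in> points (E i) \<Longrightarrow> f (g p) = p"
  shows "i dvd j"
proof -
  have mem: "proj (E k) x \<in> points (E k)" if "0 < k" for k x
    using lattice_quotient.proj_in_points[OF lattice_quotient_E[OF that]] by (simp add: E_def)
  obtain F where F: "continuous_on UNIV F" "\<And>x. proj (E i) (F x) = f (proj (E j) x)"
    using smooth_map_lift[OF j i f] by metis
  obtain G where G: "continuous_on UNIV G" "\<And>x. proj (E j) (G x) = g (proj (E i) x)"
    using smooth_map_lift[OF i j g] by metis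
  obtain \<phi> where phi: "\<And>l. l \<in> Lambda j \<Longrightarrow> \<phi> l \<in> Lambda i"
    "\<And>l x. l \<in> Lambda j \<Longrightarrow> F (l \<otimes>\<^bsub>H3\<^esub> x) = \<phi> l \<otimes>\<^bsub>H3\<^esub> F x"
    using lift_equivariant[OF j i F] by blast
  obtain \<psi> where psi: "\<And>l. l \<in> Lambda i \<Longrightarrow> \<psi> l \<in> Lambda j"
    "\<And>l x. l \<in> Lambda i \<Longrightarrow> G (l \<otimes>\<^bsub>H3\<^esub> x) = \<psi> l \<otimes>\<^bsub>H3\<^esub> G x"
    using lift_equivariant[OF i j G] by blast
  obtain c where c: "c \<in> Lambda j" "\<And>x. G (F x) = c \<otimes>\<^bsub>H3\<^esub> x"
    using lift_of_identity[OF j, of "\<lambda>x. G (F x)"] continuous_on_compose2[OF G(1) F(1)]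
    by (auto simp: F(2) G(2) gf mem[OF j])
  obtain d where d: "d \<in> Lambda i" "\<And>x. F (G x) = d \<otimes>\<^bsub>H3\<^esub> x"
    using lift_of_identity[OF i, of "\<lambda>x. F (G x)"] continuous_on_compose2[OF F(1) G(1)]
    by (auto simp: F(2) G(2) fg mem[OF i])
  have mult: "l \<otimes>\<^bsub>H3\<^esub> m \<in> Lambda k" "inv\<^bsub>H3\<^esub> l \<in> Lambda k" if "0 < k" "l \<in> Lambda k" "m \<in> Lambda k" for k l m
    using that subgroup_Lambda subgroup.m_closed subgroup.m_inv_closed by metis+
  \<comment> \<open>Compare the two ways of computing \<open>F (l m 0)\<close> and cancel
    \<open>F 0\<close>.\<close>
  have hom: "\<phi> (l \<otimes>\<^bsub>H3\<^esub> m) = \<phi> l \<otimes>\<^bsub>H3\<^esub> \<phi> m" if "l \<in> Lambda j" "m \<in> Lambda j" for l m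
    using phi(2)[of "l \<otimes>\<^bsub>H3\<^esub> m" 0] phi(2)[of l "m \<otimes>\<^bsub>H3\<^esub> 0"] phi(2)[of m 0] mult[OF j that] that
    by (simp add: H3.m_assoc[symmetric] del: H3_simps(2,3))
  have hom': "\<psi> (l \<otimes>\<^bsub>H3\<^esub> m) = \<psi> l \<otimes>\<^bsub>H3\<^esub> \<psi> m" if "l \<in> Lambda i" "m \<in> Lambda i" for l m
    using psi(2)[of "l \<otimes>\<^bsub>H3\<^esub> m" 0] psi(2)[of l "m \<otimes>\<^bsub>H3\<^esub> 0"] psi(2)[of m 0] mult[OF i that] that
    by (simp add: H3.m_assoc[symmetric] del: H3_simps(2,3))
  \<comment> \<open>\<open>G (F l)\<close> equals both \<open>c l\<close> and
    \<open>\<psi> (\<phi> l) c\<close>: the composite is conjugation by \<open>c\<close>.\<close>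
  have psiphi: "\<psi> (\<phi> l) \<otimes>\<^bsub>H3\<^esub> c = c \<otimes>\<^bsub>H3\<^esub> l" if "l \<in> Lambda j" for l
    using c(2)[of "l \<otimes>\<^bsub>H3\<^esub> 0"] phi[OF that] psi(2)[of "\<phi> l" "F 0"] c(2)[of 0]
    by (simp add: H3.m_assoc[symmetric] del: H3_simps(2,3))
  have phipsi: "\<phi> (\<psi> l) \<otimes>\<^bsub>H3\<^esub> d = d \<otimes>\<^bsub>H3\<^esub> l" if "l \<in> Lambda i" for l
    using d(2)[of "l \<otimes>\<^bsub>H3\<^esub> 0"] psi[OF that] phi(2)[of "\<psi> l" "G 0"] d(2)[of 0]
    by (simp add: H3.m_assoc[symmetric] del: H3_simps(2,3))
  have surj: "\<exists>l\<in>Lambda j. \<phi> l = m" if m: "m \<in> Lambda i" for m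
  proof -
    \<comment> \<open>\<open>m\<close> is conjugated by \<open>d\<close> beforehand, so that the
      conjugation in \<open>phipsi\<close> returns \<open>m\<close> itself.\<close>
    have n: "inv\<^bsub>H3\<^esub> d \<otimes>\<^bsub>H3\<^esub> m \<otimes>\<^bsub>H3\<^esub> d \<in> Lambda i" using mult(1)[OF i mult(1)[OF i mult(2)[OF i d(1) d(1)] m] d(1)] .
    have "\<phi> (\<psi> (inv\<^bsub>H3\<^esub> d \<otimes>\<^bsub>H3\<^esub> m \<otimes>\<^bsub>H3\<^esub> d)) \<otimes>\<^bsub>H3\<^esub> d = m \<otimes>\<^bsub>H3\<^esub> d"
      unfolding phipsi[OF n] by (simp add: H3.m_assoc[symmetric] del: H3_simps(2,3) H3_inv)
    then show ?thesis using psi(1)[OF n] by (auto simp del: H3_simps(2,3) H3_inv)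
  qed
  have surj': "\<exists>l\<in>Lambda i. \<psi> l = m" if m: "m \<in> Lambda j" for m
  proof -
    have n: "inv\<^bsub>H3\<^esub> c \<otimes>\<^bsub>H3\<^esub> m \<otimes>\<^bsub>H3\<^esub> c \<in> Lambda j" using mult(1)[OF j mult(1)[OF j mult(2)[OF j c(1) c(1)] m] c(1)] .
    have "\<psi> (\<phi> (inv\<^bsub>H3\<^esub> c \<otimes>\<^bsub>H3\<^esub> m \<otimes>\<^bsub>H3\<^esub> c)) \<otimes>\<^bsub>H3\<^esub> c = m \<otimes>\<^bsub>H3\<^esub> c"
      unfolding psiphi[OF n] by (simp add: H3.m_assoc[symmetric] del: H3_simps(2,3) H3_inv)
    then show ?thesis using phi(1)[OF n] by (auto simp del: H3_simps(2,3) H3_inv)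
  qed
  obtain a :: int where a: "\<And>n::int. \<phi> (0, 0, n / (2 * real j)) = (0, 0, real_of_int n * real_of_int a / (2 * real i))"
    using central_hom_linear[OF j i phi(1) hom surj] by blast
  obtain b :: int where b: "\<And>n::int. \<psi> (0, 0, n / (2 * real i)) = (0, 0, real_of_int n * real_of_int b / (2 * real j))"
    using central_hom_linear[OF i j psi(1) hom' surj'] by blast
  \<comment> \<open>Conjugation by \<open>c\<close> fixes the centre, so \<open>\<psi>\<close> after
    \<open>\<phi>\<close> is the identity on the generator.\<close>
  have ab: "a * b = 1"
  proof -
    obtain c1 c2 c3 where c': "c = (c1, c2, c3)" by (cases c)
    have "(0, 0, 1 / (2 * real j)) \<in> Lambda j" using j by (simp add: Lambda_iff[OF j])
    from psiphi[OF this] have "real_of_int (a * b) = 1"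
      using a[of 1] b[of a] j by (simp add: c')
    then show ?thesis by (simp only: of_int_eq_1_iff)
  qed
  \<comment> \<open>This number is the central coordinate of \<open>\<phi> (0, 0, 1)\<close>, where
    \<open>(0, 0, 1)\<close> is \<open>2 j\<close> times the generator. Being the image of a
    commutator, it equals \<open>p q' - q p'\<close> with integral entries.\<close>
  have "real j * a / real i \<in> \<int>"
  proof -
    have e: "(1, 0, 0) \<in> Lambda j" "(0, 1, 0) \<in> Lambda j" "(0, 0, 1) \<in> Lambda j"
      by (simp_all add: Lambda_iff[OF j])
    have ee: "(0, 1, 0) \<otimes>\<^bsub>H3\<^esub> (1, 0, 0) \<in> Lambda j" using mult(1)[OF j e(2,1)] .
    have "(1, 0, 0) \<otimes>\<^bsub>H3\<^esub> (0, 1, 0) = (0, 0, 1) \<otimes>\<^bsub>H3\<^esub> ((0, 1, 0) \<otimes>\<^bsub>H3\<^esub> (1, 0, 0))" by simp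
    then have comm: "\<phi> (1, 0, 0) \<otimes>\<^bsub>H3\<^esub> \<phi> (0, 1, 0) = \<phi> (0, 0, 1) \<otimes>\<^bsub>H3\<^esub> (\<phi> (0, 1, 0) \<otimes>\<^bsub>H3\<^esub> \<phi> (1, 0, 0))"
      using hom[OF e(1,2)] hom[OF e(2,1)] hom[OF e(3) ee] by metis
    define t where "t = real j * a / real i"
    have z: "\<phi> (0, 0, 1) = (0, 0, t)"
      using a[of "2 * int j"] j by (simp add: t_def)
    obtain p q r where x: "\<phi> (1, 0, 0) = (p, q, r)" by (cases "\<phi> (1, 0, 0)")
    obtain p' q' r' where y: "\<phi> (0, 1, 0) = (p', q', r')" by (cases "\<phi> (0, 1, 0)")
    have "p \<in> \<int>" "q \<in> \<int>" "p' \<in> \<int>" "q' \<in> \<int>"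
      using phi(1)[OF e(1)] phi(1)[OF e(2)] by (simp_all add: x y Lambda_iff[OF i])
    moreover have "(p * q' - q * p') / 2 = t + (p' * q - q' * p) / 2"
      using comm by (simp add: x y z)
    then have "(p * q' - q * p') / 2 = t + (q * p' - p * q') / 2"
      by (simp only: mult.commute[of p' q] mult.commute[of q' p])
    then have "t = p * q' - q * p'" by (rule swap_difference)
    ultimately show ?thesis by (simp flip: t_def)
  qed
  then obtain n :: int where "real j * a / real i = n" by (auto elim: Ints_cases)
  then have "real_of_int (int j * a) = real_of_int (n * int i)" using i by (simp add: field_simps)
  then have "int j * a = n * int i" by (simp only: of_int_eq_iff)
  \<comment> \<open>Multiplying by \<open>b\<close> removes the unit \<open>a\<close>.\<close>
  then have "int j = int i * (n * b)"
    using ab by (metis mult.assoc mult.commute mult.right_neutral)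
  then show ?thesis by (metis dvd_triv_left int_dvd_int_iff)
qed

text \<open>Divisibility is obtained in both directions, from the diffeomorphism and from its
  inverse.\<close>

lemma not_diffeomorphic_E:
  assumes "0 < j" "0 < i" "j \<noteq> i"
  shows "\<not> diffeomorphic (E j) (E i)"
proof
  assume "diffeomorphic (E j) (E i)"
  then obtain f where f: "bij_betw f (points (E j)) (points (E i))" "smooth_map (E j) (E i) f"
    "smooth_map (E i) (E j) (the_inv_into (points (E j)) f)"
    unfolding diffeomorphic_def by blast
  have "the_inv_into (points (E j)) f (f p) = p" if "p \<in> points (E j)" for p
    using f(1) that by (simp add: bij_betw_def the_inv_into_f_f)
  moreover have "f (the_inv_into (points (E j)) f p) = p" if "p \<in> points (E i)" for p
    using f(1) that by (simp add: bij_betw_def f_the_inv_into_f)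
  ultimately have "i dvd j" "j dvd i"
    using diffeomorphic_imp_dvd[OF assms(1,2) f(2,3)] diffeomorphic_imp_dvd[OF assms(2,1) f(3,2)] by auto
  then show False using assms(3) by (simp add: dvd_antisym)
qed

theorem mainTheorem5:
  fixes j k :: nat and H :: "(real \<times> real \<times> real) form"
  assumes "0 < j" and "0 < k"
    and "diff_form 3 (carrier H3) H"
    and "left_invariant 3 H3 H"
    and "closed_form 3 (carrier H3) H"
    and "nonzero_form 3 (carrier H3) H"
  shows "invariantly_T_dual (E_bundle k) (induced H) (E_bundle j) (induced H) \<and>
    (\<forall>j'. 0 < j' \<longrightarrow> j \<noteq> j' \<longrightarrow> \<not> diffeomorphic (E j) (E j'))"
  using invariantly_T_dual_E[OF assms] not_diffeomorphic_E[OF assms(1)] by blast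

end
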